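(* Let $M=I\times_f L$ be a Friedmann model. Then $M$ admits a unique GRW decomposition, even locally: for every nonempty connected open subset $O\subset M$, if $(O,g|_O)$ is isometric to a GRW space $J\times_h N$, then the two canonical foliations of $J\times N$ correspond under the isometry to the restrictions to $O$ of the canonical foliations of $I\times L$ (integral curves of $\frac{\partial}{\partial t}$, and orthogonal hypersurfaces); equivalently, every timelike, closed and conformal vector field on $O$ is a constant multiple of $f\frac{\partial}{\partial t}$.
   Context: A GRW (Generalized Robertson-Walker) space $I\times_f L$ is a product $I\times L$, with $I\subset\mathbb{R}$ an open interval and $(L,g_0)$ a connected Riemannian manifold, with metric $g=-dt^2+f(t)^2g_0$, where $f\in C^\infty(I)$ is positive. A Friedmann model is a four dimensional GRW space $I\times_f L$ with $L$ a connected $3$-dimensional Riemannian manifold of constant sectional curvature $k\in\{-1,0,1\}$ (a Robertson-Walker spacetime) modelling a dust (zero pressure perfect fluid with positive energy density), so that the non constant function $f$ satisfies the Friedmann equation $f'^2+k=\frac{A}{f}$ for some constant $A>0$. A vector field is closed if its metrically equivalent one-form is closed; a vector field $V$ is closed and conformal if and only if $\nabla_XV=a\,X$ for all $X$, for some function $a$. Uniqueness of a decomposition means that the corresponding foliations are uniquely determined. *)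

theory Defs
  imports "HOL-Analysis.Analysis"
begin

text \<open>Smoothness; only meaningful (and only used) on open subsets of Euclidean spaces, where
  continuity of all iterated directional derivatives is the usual notion of class \<open>C\<^sup>k\<close>.\<close>

primrec Ck_on :: "nat \<Rightarrow> 'a::real_normed_vector set \<Rightarrow> ('a \<Rightarrow> 'b::real_normed_vector) \<Rightarrow> bool" where
  "Ck_on 0 S f \<longleftrightarrow> continuous_on S f"
| "Ck_on (Suc k) S f \<longleftrightarrow>
     (\<forall>x\<in>S. f differentiable (at x)) \<and> (\<forall>v. Ck_on k S (\<lambda>x. frechet_derivative f (at x) v))"

definition smooth_on :: "'a::real_normed_vector set \<Rightarrow> ('a \<Rightarrow> 'b::real_normed_vector) \<Rightarrow> bool" where
  "smooth_on S f \<longleftrightarrow> (\<forall>k. Ck_on k S f)"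


text \<open>A smooth manifold modelled on \<open>'e\<close> is given by its topology and an atlas indexed by a set of
  type \<open>'i\<close>. Tangent vectors and tensors are represented by their components in the
  charts, so a metric is a bilinear form \<open>gmet M i p\<close> on \<open>'e\<close> for every chart \<open>i\<close> and every point
  \<open>p\<close> of its domain. Only indices in \<open>idx M\<close> and points in \<open>cdom M i\<close> are relevant.\<close>

record ('m, 'e, 'i) metric_manifold =
  mtop :: "'m topology"
  idx :: "'i set"
  cdom :: "'i \<Rightarrow> 'm set"
  cmap :: "'i \<Rightarrow> 'm \<Rightarrow> 'e"
  gmet :: "'i \<Rightarrow> 'm \<Rightarrow> 'e \<Rightarrow> 'e \<Rightarrow> real"

abbreviation cimg :: "('m, 'e, 'i) metric_manifold \<Rightarrow> 'i \<Rightarrow> 'e set" where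
  "cimg M i \<equiv> cmap M i ` cdom M i"

definition cinv :: "('m, 'e, 'i) metric_manifold \<Rightarrow> 'i \<Rightarrow> 'e \<Rightarrow> 'm" where
  "cinv M i = inv_into (cdom M i) (cmap M i)"

definition second_countable_top :: "'m topology \<Rightarrow> bool" where
  "second_countable_top X \<longleftrightarrow>
     (\<exists>\<B>. countable \<B> \<and> (\<forall>B\<in>\<B>. openin X B) \<and>
        (\<forall>U x. openin X U \<and> x \<in> U \<longrightarrow> (\<exists>B\<in>\<B>. x \<in> B \<and> B \<subseteq> U)))"

definition smooth_manifold :: "('m, 'e::euclidean_space, 'i) metric_manifold \<Rightarrow> bool" where
  "smooth_manifold M \<longleftrightarrow>
     Hausdorff_space (mtop M) \<and> second_countable_top (mtop M) \<and>
     topspace (mtop M) = (\<Union>i\<in>idx M. cdom M i) \<and>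
     (\<forall>i\<in>idx M. openin (mtop M) (cdom M i) \<and> open (cimg M i) \<and>
        homeomorphic_map (subtopology (mtop M) (cdom M i)) (top_of_set (cimg M i)) (cmap M i)) \<and>
     (\<forall>i\<in>idx M. \<forall>j\<in>idx M.
        smooth_on (cmap M i ` (cdom M i \<inter> cdom M j)) (cmap M j \<circ> cinv M i))"

definition chart_deriv :: "('m, 'e::real_normed_vector, 'i) metric_manifold \<Rightarrow> 'i \<Rightarrow>
    ('m \<Rightarrow> 'b::real_normed_vector) \<Rightarrow> 'm \<Rightarrow> 'e \<Rightarrow> 'b" where
  "chart_deriv M i F p u = frechet_derivative (F \<circ> cinv M i) (at (cmap M i p)) u"

definition smooth_map :: "('m, 'e::euclidean_space, 'i) metric_manifold \<Rightarrow>
    ('n, 'f::euclidean_space, 'j) metric_manifold \<Rightarrow> ('m \<Rightarrow> 'n) \<Rightarrow> bool" where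
  "smooth_map M N \<phi> \<longleftrightarrow>
     continuous_map (mtop M) (mtop N) \<phi> \<and>
     (\<forall>i\<in>idx M. \<forall>j\<in>idx N.
        smooth_on (cmap M i ` {p \<in> cdom M i. \<phi> p \<in> cdom N j}) (cmap N j \<circ> \<phi> \<circ> cinv M i))"

text \<open>The differential of \<open>\<phi>\<close> at \<open>p\<close> with respect to chart \<open>i\<close> around \<open>p\<close> and chart \<open>j\<close> around
  \<open>\<phi> p\<close>.\<close>

definition differential :: "('m, 'e::real_normed_vector, 'i) metric_manifold \<Rightarrow>
    ('n, 'f::real_normed_vector, 'j) metric_manifold \<Rightarrow> ('m \<Rightarrow> 'n) \<Rightarrow> 'i \<Rightarrow> 'j \<Rightarrow> 'm \<Rightarrow> 'e \<Rightarrow> 'f" where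
  "differential M N \<phi> i j p = chart_deriv M i (cmap N j \<circ> \<phi>) p"

definition smooth_vector_field :: "('m, 'e::euclidean_space, 'i) metric_manifold \<Rightarrow>
    ('i \<Rightarrow> 'm \<Rightarrow> 'e) \<Rightarrow> bool" where
  "smooth_vector_field M V \<longleftrightarrow>
     (\<forall>i\<in>idx M. smooth_on (cimg M i) (V i \<circ> cinv M i)) \<and>
     (\<forall>i\<in>idx M. \<forall>j\<in>idx M. \<forall>p\<in>cdom M i \<inter> cdom M j.
        V j p = differential M M id i j p (V i p))"

definition riemannian_manifold :: "('m, 'e::euclidean_space, 'i) metric_manifold \<Rightarrow> bool" where
  "riemannian_manifold M \<longleftrightarrow>
     smooth_manifold M \<and>
     (\<forall>i\<in>idx M. \<forall>p\<in>cdom M i. bilinear (gmet M i p) \<and>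
        (\<forall>u v. gmet M i p u v = gmet M i p v u) \<and> (\<forall>u. u \<noteq> 0 \<longrightarrow> gmet M i p u u > 0)) \<and>
     (\<forall>i\<in>idx M. \<forall>u v. smooth_on (cimg M i) (\<lambda>x. gmet M i (cinv M i x) u v)) \<and>
     (\<forall>i\<in>idx M. \<forall>j\<in>idx M. \<forall>p\<in>cdom M i \<inter> cdom M j. \<forall>u v.
        gmet M i p u v = gmet M j p (differential M M id i j p u) (differential M M id i j p v))"

definition isometry :: "('m, 'e::euclidean_space, 'i) metric_manifold \<Rightarrow>
    ('n, 'f::euclidean_space, 'j) metric_manifold \<Rightarrow> ('m \<Rightarrow> 'n) \<Rightarrow> bool" where
  "isometry M N \<phi> \<longleftrightarrow>
     smooth_map M N \<phi> \<and>
     (\<exists>\<psi>. smooth_map N M \<psi> \<and> (\<forall>p\<in>topspace (mtop M). \<psi> (\<phi> p) = p) \<and>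
        (\<forall>q\<in>topspace (mtop N). \<phi> (\<psi> q) = q)) \<and>
     (\<forall>i\<in>idx M. \<forall>j\<in>idx N. \<forall>p\<in>cdom M i. \<phi> p \<in> cdom N j \<longrightarrow>
        (\<forall>u v. gmet M i p u v
           = gmet N j (\<phi> p) (differential M N \<phi> i j p u) (differential M N \<phi> i j p v)))"

definition open_submanifold :: "('m, 'e, 'i) metric_manifold \<Rightarrow> 'm set \<Rightarrow> ('m, 'e, 'i) metric_manifold" where
  "open_submanifold M \<Omega> = M\<lparr>mtop := subtopology (mtop M) \<Omega>, cdom := (\<lambda>i. cdom M i \<inter> \<Omega>)\<rparr>"


text \<open>The Christoffel symbols as a map \<open>\<Gamma>(v,w) = \<nabla>\<^sub>v w\<close> on coordinate-constant fields
  (Koszul formula), and \<open>R(u,v)w = \<nabla>\<^sub>u\<nabla>\<^sub>v w - \<nabla>\<^sub>v\<nabla>\<^sub>u w\<close> for such fields; with this sign the unit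
  sphere has sectional curvature \<open>1\<close>.\<close>

definition christoffel :: "('m, 'e::euclidean_space, 'i) metric_manifold \<Rightarrow> 'i \<Rightarrow> 'm \<Rightarrow> 'e \<Rightarrow> 'e \<Rightarrow> 'e" where
  "christoffel M i p v w = (THE y. \<forall>z. gmet M i p y z =
     (chart_deriv M i (\<lambda>q. gmet M i q w z) p v + chart_deriv M i (\<lambda>q. gmet M i q v z) p w
        - chart_deriv M i (\<lambda>q. gmet M i q v w) p z) / 2)"

definition riemann_curvature :: "('m, 'e::euclidean_space, 'i) metric_manifold \<Rightarrow> 'i \<Rightarrow> 'm \<Rightarrow>
    'e \<Rightarrow> 'e \<Rightarrow> 'e \<Rightarrow> 'e" where
  "riemann_curvature M i p u v w =
     chart_deriv M i (\<lambda>q. christoffel M i q v w) p u - chart_deriv M i (\<lambda>q. christoffel M i q u w) p v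
     + christoffel M i p u (christoffel M i p v w) - christoffel M i p v (christoffel M i p u w)"

definition sectional_curvature :: "('m, 'e::euclidean_space, 'i) metric_manifold \<Rightarrow> 'i \<Rightarrow> 'm \<Rightarrow>
    'e \<Rightarrow> 'e \<Rightarrow> real" where
  "sectional_curvature M i p u v = gmet M i p (riemann_curvature M i p u v v) u /
     (gmet M i p u u * gmet M i p v v - (gmet M i p u v)\<^sup>2)"

definition constant_sectional_curvature :: "('m, 'e::euclidean_space, 'i) metric_manifold \<Rightarrow> real \<Rightarrow> bool" where
  "constant_sectional_curvature M k \<longleftrightarrow>
     (\<forall>i\<in>idx M. \<forall>p\<in>cdom M i. \<forall>u v. u \<noteq> v \<and> independent {u, v} \<longrightarrow> sectional_curvature M i p u v = k)"


definition timelike_field :: "('m, 'e::euclidean_space, 'i) metric_manifold \<Rightarrow> ('i \<Rightarrow> 'm \<Rightarrow> 'e) \<Rightarrow> bool" where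
  "timelike_field M V \<longleftrightarrow> (\<forall>i\<in>idx M. \<forall>p\<in>cdom M i. gmet M i p (V i p) (V i p) < 0)"

text \<open>The metrically equivalent one-form \<open>g(V, \<sqdot>)\<close> has vanishing exterior derivative.\<close>

definition closed_field :: "('m, 'e::euclidean_space, 'i) metric_manifold \<Rightarrow> ('i \<Rightarrow> 'm \<Rightarrow> 'e) \<Rightarrow> bool" where
  "closed_field M V \<longleftrightarrow> (\<forall>i\<in>idx M. \<forall>p\<in>cdom M i. \<forall>u v.
     chart_deriv M i (\<lambda>q. gmet M i q (V i q) v) p u
       - chart_deriv M i (\<lambda>q. gmet M i q (V i q) u) p v = 0)"

definition lie_deriv_metric :: "('m, 'e::euclidean_space, 'i) metric_manifold \<Rightarrow> ('i \<Rightarrow> 'm \<Rightarrow> 'e) \<Rightarrow>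
    'i \<Rightarrow> 'm \<Rightarrow> 'e \<Rightarrow> 'e \<Rightarrow> real" where
  "lie_deriv_metric M V i p u v =
     chart_deriv M i (\<lambda>q. gmet M i q u v) p (V i p)
     + gmet M i p (chart_deriv M i (V i) p u) v + gmet M i p u (chart_deriv M i (V i) p v)"

definition conformal_field :: "('m, 'e::euclidean_space, 'i) metric_manifold \<Rightarrow> ('i \<Rightarrow> 'm \<Rightarrow> 'e) \<Rightarrow> bool" where
  "conformal_field M V \<longleftrightarrow> (\<exists>a :: 'm \<Rightarrow> real. \<forall>i\<in>idx M. \<forall>p\<in>cdom M i. \<forall>u v.
     lie_deriv_metric M V i p u v = 2 * a p * gmet M i p u v)"


text \<open>The warped product \<open>I \<times>\<^sub>f L\<close> with metric \<open>-dt\<^sup>2 + f(t)\<^sup>2 g\<^sub>0\<close>, with the charts \<open>id \<times> cmap L i\<close>.\<close>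

definition warped_product :: "real set \<Rightarrow> (real \<Rightarrow> real) \<Rightarrow> ('l, 'e, 'i) metric_manifold \<Rightarrow>
    (real \<times> 'l, real \<times> 'e, 'i) metric_manifold" where
  "warped_product I f L = \<lparr>
     mtop = prod_topology (top_of_set I) (mtop L),
     idx = idx L,
     cdom = (\<lambda>i. I \<times> cdom L i),
     cmap = (\<lambda>i (t, p). (t, cmap L i p)),
     gmet = (\<lambda>i (t, p) (\<tau>, u) (\<sigma>, v). - (\<tau> * \<sigma>) + (f t)\<^sup>2 * gmet L i p u v)\<rparr>"

definition is_GRW :: "real set \<Rightarrow> (real \<Rightarrow> real) \<Rightarrow> ('l, 'e::euclidean_space, 'i) metric_manifold \<Rightarrow> bool" where
  "is_GRW I f L \<longleftrightarrow>
     I \<noteq> {} \<and> open I \<and> is_interval I \<and> smooth_on I f \<and> (\<forall>t\<in>I. f t > 0) \<and>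
     riemannian_manifold L \<and> connected_space (mtop L)"

definition is_Friedmann :: "real set \<Rightarrow> (real \<Rightarrow> real) \<Rightarrow> ('l, real ^ 3, 'i) metric_manifold \<Rightarrow> bool" where
  "is_Friedmann I f L \<longleftrightarrow>
     is_GRW I f L \<and> \<not> f constant_on I \<and>
     (\<exists>k\<in>{-1, 0, 1}. constant_sectional_curvature L k \<and>
        (\<exists>A>0. \<forall>t\<in>I. (deriv f t)\<^sup>2 + k = A / f t))"

text \<open>Foliations are represented by their sets of leaves; the leaves of the restriction of a
  foliation (with embedded leaves) to an open set are the connected components of the intersections.\<close>

definition time_foliation :: "real set \<Rightarrow> ('l, 'e, 'i) metric_manifold \<Rightarrow> (real \<times> 'l) set set" where
  "time_foliation I L = {I \<times> {x} | x. x \<in> topspace (mtop L)}"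

definition slice_foliation :: "real set \<Rightarrow> ('l, 'e, 'i) metric_manifold \<Rightarrow> (real \<times> 'l) set set" where
  "slice_foliation I L = {{t} \<times> topspace (mtop L) | t. t \<in> I}"

definition restrict_foliation :: "'m topology \<Rightarrow> 'm set set \<Rightarrow> 'm set \<Rightarrow> 'm set set" where
  "restrict_foliation X \<F> \<Omega> = (\<Union>S\<in>\<F>. connected_components_of (subtopology X (S \<inter> \<Omega>)))"

definition f_dt :: "(real \<Rightarrow> real) \<Rightarrow> 'i \<Rightarrow> real \<times> 'l \<Rightarrow> real \<times> 'e::zero" where
  "f_dt f = (\<lambda>i (t, x). (f t, 0))"

end

theory Submission
  imports Defs
begin

text \<open>
  Let \<open>V = (\<phi>, W)\<close> be closed and conformal on a chart of \<open>I \<times>\<^sub>f L\<close>, with \<open>\<nabla>\<^sub>X V = a X\<close>. In components this says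
  \<open>\<partial>\<^sub>t W = - (f'/f) W\<close>, \<open>\<partial>\<^sub>v \<phi> = - f f' g\<^sub>0(W, v)\<close> and \<open>\<nabla>\<^sub>v W = b v\<close> in \<open>L\<close>, where
  \<open>b = \<partial>\<^sub>t \<phi> - \<phi> f'/f\<close>. The first two equations give \<open>\<partial>\<^sub>v b = (f'\<^sup>2 - f f'') g\<^sub>0(W, v)\<close>. Differentiating the
  third gives \<open>R(u, W) W = (\<partial>\<^sub>u b) W - (\<partial>\<^sub>W b) u\<close>; pairing it with some \<open>u \<noteq> 0\<close> orthogonal to \<open>W\<close>, constant
  curvature \<open>k\<close> forces \<open>\<partial>\<^sub>W b = - k g\<^sub>0(W, W)\<close>. Hence \<open>(f'\<^sup>2 + k - f f'') g\<^sub>0(W, W) = 0\<close>, and the Friedmann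
  equation turns the first factor into \<open>3 A / (2 f) > 0\<close>. So \<open>W = 0\<close> and \<open>\<phi> / f\<close> is locally constant.

  A GRW decomposition \<open>J \<times>\<^sub>h N\<close> carries the closed conformal field \<open>h \<partial>\<^sub>s\<close>. Its pullback under an isometry is
  therefore vertical, so the isometry and its inverse map time lines to time lines and slices to slices
  locally; since the leaves of \<open>J \<times> N\<close> are connected, they correspond to the components of the leaves in \<open>\<Omega>\<close>.
\<close>

section \<open>Calculus of class C^k\<close>

text \<open>The covariant derivative of \<open>V\<close> is never formed. The conformal equation is
  its symmetric part and closedness its antisymmetric part; evaluating both on time and space
  directions yields the component equations, so the local argument stays in one product chart and
  uses ordinary derivatives. Three points shape the proof. The Christoffel symbols are given by a
  definite description, so their differentiability, without which the third equation cannot be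
  differentiated, has to come from solving the linear system behind it. The derivative of b contains
  a mixed second derivative of \<phi>, hence symmetry of second derivatives is needed for this
  notion of C^k. And differentiating the Friedmann equation only gives f' (2 f'' + A/f^2) = 0, which
  is silent where f' vanishes; that the second factor is zero everywhere is a global statement on
  the interval, resting on f not being constant. Then f f'' = - A/(2 f), and A/f + A/(2 f) is the
  value 3 A/(2 f).\<close>

abbreviation dd :: "('a::real_normed_vector \<Rightarrow> 'b::real_normed_vector) \<Rightarrow> 'a \<Rightarrow> 'a \<Rightarrow> 'b" where
  "dd f x v \<equiv> frechet_derivative f (at x) v"

lemma has_derivative_dd: "f differentiable (at x) \<Longrightarrow> (f has_derivative dd f x) (at x)"
  by (simp add: frechet_derivative_works)

lemma dd_eqI: "(f has_derivative f') (at x) \<Longrightarrow> dd f x = f'"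
  using frechet_derivative_at by metis

lemma dd_cong_open:
  assumes "open S" "x \<in> S" "\<And>y. y \<in> S \<Longrightarrow> f y = g y"
  shows "dd f x = dd g x"
proof -
  have "(f has_derivative F) (at x) \<longleftrightarrow> (g has_derivative F) (at x)" for F
    using assms has_derivative_transform_within_open[of f F x UNIV S g]
      has_derivative_transform_within_open[of g F x UNIV S f] by auto
  then show ?thesis by (simp add: frechet_derivative_def)
qed

lemma differentiable_cong_open:
  assumes "open S" "x \<in> S" "\<And>y. y \<in> S \<Longrightarrow> f y = g y" "f differentiable (at x)"
  shows "g differentiable (at x)"
  using assms by (meson differentiable_def has_derivative_transform_within_open)

lemma Ck_on_cong:
  assumes "open S" "Ck_on k S f" "\<And>x. x \<in> S \<Longrightarrow> f x = g x"
  shows "Ck_on k S g"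
  using assms(2,3)
proof (induction k arbitrary: f g)
  case 0
  then show ?case using continuous_on_cong[of S S f g] by simp
next
  case (Suc k)
  have "Ck_on k S (\<lambda>x. dd g x v)" for v
  proof (rule Suc.IH[of "\<lambda>x. dd f x v"])
    show "Ck_on k S (\<lambda>x. dd f x v)" using Suc.prems by simp
    show "\<And>x. x \<in> S \<Longrightarrow> dd f x v = dd g x v"
      using dd_cong_open[OF assms(1) _ Suc.prems(2)] by simp
  qed
  then show ?case
    using Suc.prems differentiable_cong_open[OF assms(1) _ Suc.prems(2)] by simp
qed

lemma Ck_on_SucI:
  assumes "open S" "\<And>x. x \<in> S \<Longrightarrow> (f has_derivative f' x) (at x)"
    and "\<And>v. Ck_on k S (\<lambda>x. f' x v)"
  shows "Ck_on (Suc k) S f"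
proof -
  have "Ck_on k S (\<lambda>x. dd f x v)" for v
    by (rule Ck_on_cong[OF assms(1) assms(3)[of v]]) (use dd_eqI[OF assms(2)] in simp)
  then show ?thesis using assms(2) by (auto intro: differentiableI)
qed

lemma Ck_on_SucD: "Ck_on (Suc k) S f \<Longrightarrow> Ck_on k S f"
proof (induction k arbitrary: f)
  case 0
  then show ?case
    by (auto intro!: continuous_at_imp_continuous_on differentiable_imp_continuous_within)
next
  case (Suc k)
  show ?case using Suc.prems Suc.IH by (simp del: Ck_on.simps(2) add: Ck_on.simps(2)[of _ S f])
qed

lemma Ck_on_subset: "Ck_on k S f \<Longrightarrow> T \<subseteq> S \<Longrightarrow> Ck_on k T f"
  by (induction k arbitrary: f) (auto intro: continuous_on_subset)

lemma Ck_on_has_derivative: "Ck_on (Suc k) S f \<Longrightarrow> x \<in> S \<Longrightarrow> (f has_derivative dd f x) (at x)"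
  by (simp add: has_derivative_dd)

lemma Ck_on_dd: "Ck_on (Suc k) S f \<Longrightarrow> Ck_on k S (\<lambda>x. dd f x v)"
  by simp

lemma Ck_on_const: "Ck_on k S (\<lambda>x. c)"
  by (induction k arbitrary: c) auto

lemma Ck_on_add: "open S \<Longrightarrow> Ck_on k S f \<Longrightarrow> Ck_on k S g \<Longrightarrow> Ck_on k S (\<lambda>x. f x + g x)"
proof (induction k arbitrary: f g)
  case 0
  then show ?case by (simp add: continuous_on_add)
next
  case (Suc k)
  show ?case
  proof (rule Ck_on_SucI[where f' = "\<lambda>x v. dd f x v + dd g x v"])
    show "((\<lambda>x. f x + g x) has_derivative (\<lambda>v. dd f x v + dd g x v)) (at x)" if "x \<in> S" for x
      using Suc.prems that by (auto intro!: has_derivative_add has_derivative_dd)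
  qed (use Suc in auto)
qed

lemma Ck_on_sum:
  "open S \<Longrightarrow> (\<And>i. i \<in> A \<Longrightarrow> Ck_on k S (f i)) \<Longrightarrow> Ck_on k S (\<lambda>x. \<Sum>i\<in>A. f i x)"
  by (induction A rule: infinite_finite_induct) (auto simp: Ck_on_const Ck_on_add)

lemma Ck_on_bounded_linear:
  assumes "bounded_linear l" "open S" "Ck_on k S f"
  shows "Ck_on k S (\<lambda>x. l (f x))"
  using assms(3)
proof (induction k arbitrary: f)
  case 0
  then show ?case using bounded_linear.continuous_on[OF assms(1)] by simp
next
  case (Suc k)
  show ?case
  proof (rule Ck_on_SucI[where f' = "\<lambda>x v. l (dd f x v)"])
    show "((\<lambda>x. l (f x)) has_derivative (\<lambda>v. l (dd f x v))) (at x)" if "x \<in> S" for x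
      using Suc.prems that
      by (auto intro!: bounded_linear.has_derivative[OF assms(1)] has_derivative_dd)
  qed (use Suc assms in auto)
qed

lemma (in bounded_bilinear) Ck_on_bilinear:
  assumes "open S"
  shows "Ck_on k S f \<Longrightarrow> Ck_on k S g \<Longrightarrow> Ck_on k S (\<lambda>x. prod (f x) (g x))"
proof (induction k arbitrary: f g)
  case 0
  then show ?case by (simp add: continuous_on)
next
  case (Suc k)
  show ?case
  proof (rule Ck_on_SucI[OF assms, where f' = "\<lambda>x v. prod (f x) (dd g x v) + prod (dd f x v) (g x)"])
    show "((\<lambda>x. prod (f x) (g x)) has_derivative
        (\<lambda>v. prod (f x) (dd g x v) + prod (dd f x v) (g x))) (at x)" if "x \<in> S" for x
      using Suc.prems that by (auto intro!: FDERIV has_derivative_dd)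
    show "Ck_on k S (\<lambda>x. prod (f x) (dd g x v) + prod (dd f x v) (g x))" for v
      using Suc.prems Ck_on_SucD[OF Suc.prems(1)] Ck_on_SucD[OF Suc.prems(2)]
      by (auto intro!: Ck_on_add assms Suc.IH)
  qed
qed

lemmas Ck_on_scaleR = bounded_bilinear.Ck_on_bilinear[OF bounded_bilinear_scaleR]
lemmas Ck_on_inner_left = Ck_on_bounded_linear[OF bounded_linear_inner_left]

lemma dd_basis_sum:
  fixes f :: "'a::euclidean_space \<Rightarrow> 'b::real_normed_vector"
  assumes "f differentiable (at x)"
  shows "dd f x v = (\<Sum>b\<in>Basis. (v \<bullet> b) *\<^sub>R dd f x b)"
proof -
  have l: "linear (dd f x)" by (rule linear_frechet_derivative[OF assms])
  have "dd f x v = dd f x (\<Sum>b\<in>Basis. (v \<bullet> b) *\<^sub>R b)" by (simp add: euclidean_representation)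
  also have "\<dots> = (\<Sum>b\<in>Basis. (v \<bullet> b) *\<^sub>R dd f x b)"
    by (simp add: linear_sum[OF l] linear_cmul[OF l])
  finally show ?thesis .
qed

text \<open>The chain rule differentiates \<open>f\<close> in the direction \<open>dd g x v\<close>,
  which moves with \<open>x\<close>, whereas \<open>Ck_on\<close> speaks only of fixed directions.
  Expanding the direction in the basis gives a finite sum of products, to which the induction
  hypothesis and the product rule apply.\<close>

lemma Ck_on_compose:
  fixes g :: "'a::real_normed_vector \<Rightarrow> 'b::euclidean_space" and f :: "'b \<Rightarrow> 'c::real_normed_vector"
  assumes "open S" "open T" "g ` S \<subseteq> T"
  shows "Ck_on k T f \<Longrightarrow> Ck_on k S g \<Longrightarrow> Ck_on k S (\<lambda>x. f (g x))"
proof (induction k arbitrary: f)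
  case 0
  then show ?case using continuous_on_compose2 assms by (metis Ck_on.simps(1))
next
  case (Suc k)
  show ?case
  proof (rule Ck_on_SucI[OF assms(1), where f' = "\<lambda>x v. \<Sum>b\<in>Basis. (dd g x v \<bullet> b) *\<^sub>R dd f (g x) b"])
    show "((\<lambda>x. f (g x)) has_derivative (\<lambda>v. \<Sum>b\<in>Basis. (dd g x v \<bullet> b) *\<^sub>R dd f (g x) b)) (at x)"
      if "x \<in> S" for x
    proof -
      have f: "f differentiable (at (g x))" and g: "g differentiable (at x)"
        using Suc.prems that assms by auto
      show ?thesis
        using has_derivative_compose[OF has_derivative_dd[OF g] has_derivative_dd[OF f]]
        by (simp add: dd_basis_sum[OF f, symmetric])
    qed
    have "Ck_on k S (\<lambda>x. dd f (g x) b)" for b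
      using Suc.IH[of "\<lambda>y. dd f y b"] Suc.prems Ck_on_SucD[OF Suc.prems(2)] by simp
    then show "Ck_on k S (\<lambda>x. \<Sum>b\<in>Basis. (dd g x v \<bullet> b) *\<^sub>R dd f (g x) b)" for v
      using Suc.prems by (intro Ck_on_sum Ck_on_scaleR Ck_on_inner_left assms(1)) auto
  qed
qed

text \<open>Two mean value theorems, along \<open>u\<close> and then along \<open>v\<close>. The
  left side is symmetric in \<open>u\<close> and \<open>v\<close> while the right side is a mixed
  derivative in one particular order, which is how the two orders get compared.\<close>

lemma second_difference_mvt:
  fixes f :: "'a::real_normed_vector \<Rightarrow> real"
  assumes C: "Ck_on 2 (ball x \<delta>) f" and t: "0 < t" "t * (norm u + norm v) < \<delta>"
  shows "\<exists>y\<in>ball x \<delta>. f (x + t *\<^sub>R u + t *\<^sub>R v) - f (x + t *\<^sub>R u) - f (x + t *\<^sub>R v) + f x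
    = t\<^sup>2 * dd (\<lambda>z. dd f z u) y v"
proof -
  have inb: "x + s *\<^sub>R u + r *\<^sub>R v \<in> ball x \<delta>" if "0 \<le> s" "s \<le> t" "0 \<le> r" "r \<le> t" for s r
  proof -
    have "norm (s *\<^sub>R u + r *\<^sub>R v) \<le> s * norm u + r * norm v"
      using that by (metis abs_of_nonneg norm_scaleR norm_triangle_ineq)
    also have "\<dots> \<le> t * norm u + t * norm v"
      using that by (intro add_mono mult_right_mono) auto
    finally have "norm (s *\<^sub>R u + r *\<^sub>R v) < \<delta>" using t(2) by (simp add: algebra_simps)
    moreover have "dist x (x + s *\<^sub>R u + r *\<^sub>R v) = norm (s *\<^sub>R u + r *\<^sub>R v)"
      unfolding dist_norm by (subst norm_minus_commute) (simp add: algebra_simps)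
    ultimately show ?thesis by simp
  qed
  have C1: "Ck_on (Suc (Suc 0)) (ball x \<delta>) f" using C by (simp add: numeral_2_eq_2)
  have df: "(f has_derivative dd f y) (at y)" if "y \<in> ball x \<delta>" for y
    using Ck_on_has_derivative[OF C1 that] .
  have ddf: "((\<lambda>z. dd f z u) has_derivative dd (\<lambda>z. dd f z u) y) (at y)" if "y \<in> ball x \<delta>" for y
    using Ck_on_has_derivative[OF Ck_on_dd[OF C1] that] .
  \<comment> \<open>The increment in direction \<open>v\<close>. Its derivative along
    \<open>u\<close> is again an increment, namely that of the first derivative
    \<open>dd f _ u\<close>, ready for the second mean value theorem.\<close>
  define q where "q s = f (x + s *\<^sub>R u + t *\<^sub>R v) - f (x + s *\<^sub>R u)" for s
  have dline: "((\<lambda>s. f (a + s *\<^sub>R w)) has_real_derivative dd f (a + s *\<^sub>R w) w) (at s)"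
    if "a + s *\<^sub>R w \<in> ball x \<delta>" for a w s
  proof -
    have "((\<lambda>s. a + s *\<^sub>R w) has_derivative (\<lambda>h. h *\<^sub>R w)) (at s)"
      by (auto intro!: derivative_eq_intros)
    from has_derivative_compose[OF this df[OF that]]
    have "((\<lambda>s. f (a + s *\<^sub>R w)) has_derivative (\<lambda>h. dd f (a + s *\<^sub>R w) (h *\<^sub>R w))) (at s)" .
    moreover have "dd f (a + s *\<^sub>R w) (h *\<^sub>R w) = dd f (a + s *\<^sub>R w) w * h" for h
      using linear_cmul[OF has_derivative_linear[OF df[OF that]]] by simp
    ultimately show ?thesis by (simp add: has_field_derivative_def)
  qed
  have dq: "(q has_real_derivative
      dd f (x + s *\<^sub>R u + t *\<^sub>R v) u - dd f (x + s *\<^sub>R u) u) (at s)" if "0 \<le> s" "s \<le> t" for s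
  proof -
    have 1: "x + t *\<^sub>R v + s *\<^sub>R u = x + s *\<^sub>R u + t *\<^sub>R v" for s by simp
    show ?thesis
      unfolding q_def
      using dline[of "x + t *\<^sub>R v" s u] dline[of x s u] inb[OF that, of t] inb[OF that, of 0] t
      by (intro DERIV_diff) (simp_all add: 1)
  qed
  have "\<exists>s>0. s < t \<and> q t - q 0
      = (t - 0) * (dd f (x + s *\<^sub>R u + t *\<^sub>R v) u - dd f (x + s *\<^sub>R u) u)"
    by (rule MVT2[OF t(1) dq])
  then obtain s where s: "0 < s" "s < t"
      "q t - q 0 = t * (dd f (x + s *\<^sub>R u + t *\<^sub>R v) u - dd f (x + s *\<^sub>R u) u)"
    by auto
  have dp: "((\<lambda>r. dd f (x + s *\<^sub>R u + r *\<^sub>R v) u) has_real_derivative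
      dd (\<lambda>z. dd f z u) (x + s *\<^sub>R u + r *\<^sub>R v) v) (at r)" if "0 \<le> r" "r \<le> t" for r
  proof -
    have b: "x + s *\<^sub>R u + r *\<^sub>R v \<in> ball x \<delta>" using inb s that by simp
    have "((\<lambda>r. x + s *\<^sub>R u + r *\<^sub>R v) has_derivative (\<lambda>h. h *\<^sub>R v)) (at r)"
      by (auto intro!: derivative_eq_intros)
    from has_derivative_compose[OF this ddf[OF b]]
    have "((\<lambda>r. dd f (x + s *\<^sub>R u + r *\<^sub>R v) u) has_derivative
        (\<lambda>h. dd (\<lambda>z. dd f z u) (x + s *\<^sub>R u + r *\<^sub>R v) (h *\<^sub>R v))) (at r)" .
    moreover have "dd (\<lambda>z. dd f z u) (x + s *\<^sub>R u + r *\<^sub>R v) (h *\<^sub>R v)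
        = dd (\<lambda>z. dd f z u) (x + s *\<^sub>R u + r *\<^sub>R v) v * h" for h
      using linear_cmul[OF has_derivative_linear[OF ddf[OF b]]] by simp
    ultimately show ?thesis by (simp add: has_field_derivative_def)
  qed
  have "\<exists>r>0. r < t \<and> dd f (x + s *\<^sub>R u + t *\<^sub>R v) u - dd f (x + s *\<^sub>R u + 0 *\<^sub>R v) u
        = (t - 0) * dd (\<lambda>z. dd f z u) (x + s *\<^sub>R u + r *\<^sub>R v) v"
    by (rule MVT2[OF t(1) dp])
  then obtain r where r: "0 < r" "r < t"
      "dd f (x + s *\<^sub>R u + t *\<^sub>R v) u - dd f (x + s *\<^sub>R u + 0 *\<^sub>R v) u
        = t * dd (\<lambda>z. dd f z u) (x + s *\<^sub>R u + r *\<^sub>R v) v"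
    by auto
  show ?thesis
  proof
    show "x + s *\<^sub>R u + r *\<^sub>R v \<in> ball x \<delta>" using inb s r by simp
    show "f (x + t *\<^sub>R u + t *\<^sub>R v) - f (x + t *\<^sub>R u) - f (x + t *\<^sub>R v) + f x
      = t\<^sup>2 * dd (\<lambda>z. dd f z u) (x + s *\<^sub>R u + r *\<^sub>R v) v"
      using s(3) r(3) by (simp add: q_def power2_eq_square)
  qed
qed

text \<open>The same second difference, divided by t^2, is a value of either mixed derivative at
  points close to \<open>x\<close>. If the two differed at \<open>x\<close>, continuity would keep
  them apart on a small ball.\<close>

lemma dd_commute_real:
  fixes f :: "'a::real_normed_vector \<Rightarrow> real"
  assumes "open S" "x \<in> S" "Ck_on 2 S f"
  shows "dd (\<lambda>z. dd f z u) x v = dd (\<lambda>z. dd f z v) x u"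
proof (rule ccontr)
  define A where "A = (\<lambda>y. dd (\<lambda>z. dd f z u) y v)"
  define B where "B = (\<lambda>y. dd (\<lambda>z. dd f z v) y u)"
  assume "\<not> ?thesis"
  then have e: "0 < dist (A x) (B x) / 2" by (simp add: A_def B_def)
  have C: "Ck_on (Suc (Suc 0)) S f" using assms(3) by (simp add: numeral_2_eq_2)
  have "continuous_on S A" "continuous_on S B"
    using C by (simp_all add: A_def B_def)
  then have "isCont A x" "isCont B x"
    using assms(1,2) continuous_on_eq_continuous_at by blast+
  then obtain d1 where d1: "0 < d1" "\<And>y. dist y x < d1 \<Longrightarrow> dist (A y) (A x) < dist (A x) (B x) / 2"
    using e unfolding continuous_at_eps_delta by blast
  obtain d2 where d2: "0 < d2" "\<And>y. dist y x < d2 \<Longrightarrow> dist (B y) (B x) < dist (A x) (B x) / 2"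
    using e \<open>isCont B x\<close> unfolding continuous_at_eps_delta by blast
  note d = d1 d2
  obtain d3 where d3: "0 < d3" "ball x d3 \<subseteq> S" using assms(1,2) open_contains_ball by blast
  define \<delta> where "\<delta> = min d1 (min d2 d3)"
  have \<delta>: "\<delta> > 0" using d d3 by (simp add: \<delta>_def)
  \<comment> \<open>The summand 1 keeps \<open>N\<close> positive when \<open>u\<close> and
    \<open>v\<close> both vanish; with this \<open>t\<close> the increments have length at most half
    of \<delta>.\<close>
  define N where "N = norm u + norm v + 1"
  have np: "N > 0" unfolding N_def by (smt (verit) norm_ge_zero)
  define t where "t = \<delta> / (2 * N)"
  have t: "0 < t" using \<delta> np by (simp add: t_def)
  have "t * (norm u + norm v) \<le> t * N" using t by (simp add: N_def)
  also have "\<dots> = \<delta> / 2" using np by (simp add: t_def)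
  also have "\<dots> < \<delta>" using \<delta> by simp
  finally have t2: "t * (norm u + norm v) < \<delta>" .
  have "ball x \<delta> \<subseteq> ball x d3" by (rule subset_ball) (simp add: \<delta>_def)
  then have Cb: "Ck_on 2 (ball x \<delta>) f" using Ck_on_subset[OF assms(3)] d3(2) by blast
  obtain y1 where y1: "y1 \<in> ball x \<delta>"
    "f (x + t *\<^sub>R u + t *\<^sub>R v) - f (x + t *\<^sub>R u) - f (x + t *\<^sub>R v) + f x = t\<^sup>2 * A y1"
    using second_difference_mvt[OF Cb t t2] unfolding A_def by blast
  obtain y2 where y2: "y2 \<in> ball x \<delta>"
    "f (x + t *\<^sub>R v + t *\<^sub>R u) - f (x + t *\<^sub>R v) - f (x + t *\<^sub>R u) + f x = t\<^sup>2 * B y2"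
    using second_difference_mvt[OF Cb t, of v u] t2 unfolding B_def by (auto simp: add.commute)
  have eq: "x + t *\<^sub>R v + t *\<^sub>R u = x + t *\<^sub>R u + t *\<^sub>R v" by simp
  have "t\<^sup>2 * A y1 = t\<^sup>2 * B y2" using y1(2) y2(2)[unfolded eq] by linarith
  then have "A y1 = B y2" using t by simp
  moreover have "dist (A y1) (A x) < dist (A x) (B x) / 2"
    by (rule d1(2)) (use y1(1) in \<open>simp add: \<delta>_def dist_commute\<close>)
  moreover have "dist (B y2) (B x) < dist (A x) (B x) / 2"
    by (rule d2(2)) (use y2(1) in \<open>simp add: \<delta>_def dist_commute\<close>)
  ultimately show False by (simp add: dist_real_def abs_if split: if_splits)
qed

text \<open>Tested against basis vectors, because the mean value theorem concerns real
  values.\<close>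

lemma dd_commute:
  fixes f :: "'a::real_normed_vector \<Rightarrow> 'b::euclidean_space"
  assumes "open S" "x \<in> S" "Ck_on 2 S f"
  shows "dd (\<lambda>z. dd f z u) x v = dd (\<lambda>z. dd f z v) x u"
proof (rule euclidean_eqI)
  fix b :: 'b assume "b \<in> Basis"
  have C: "Ck_on (Suc (Suc 0)) S f" using assms(3) by (simp add: numeral_2_eq_2)
  have i: "dd (\<lambda>z. h z \<bullet> b) y w = dd h y w \<bullet> b" if "h differentiable (at y)" for h :: "'a \<Rightarrow> 'b" and y w
    using dd_eqI[OF bounded_linear.has_derivative[OF bounded_linear_inner_left has_derivative_dd[OF that]]]
    by metis
  have s: "dd (\<lambda>z. dd f z w) x w' \<bullet> b = dd (\<lambda>z. dd (\<lambda>y. f y \<bullet> b) z w) x w'" for w w'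
  proof -
    have "dd (\<lambda>z. dd (\<lambda>y. f y \<bullet> b) z w) x = dd (\<lambda>z. dd f z w \<bullet> b) x"
      by (rule dd_cong_open[OF assms(1,2)]) (use C i in simp)
    moreover have "dd (\<lambda>z. dd f z w \<bullet> b) x w' = dd (\<lambda>z. dd f z w) x w' \<bullet> b"
      using C assms(2) by (intro i) auto
    ultimately show ?thesis by simp
  qed
  show "dd (\<lambda>z. dd f z u) x v \<bullet> b = dd (\<lambda>z. dd f z v) x u \<bullet> b"
    unfolding s by (rule dd_commute_real[OF assms(1,2) Ck_on_inner_left[OF assms(1,3)]])
qed

section \<open>Christoffel symbols in a chart\<close>

lemma dd_add:
  assumes "f differentiable (at x)" "g differentiable (at x)"
  shows "dd (\<lambda>y. f y + g y) x v = dd f x v + dd g x v"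
  using dd_eqI[OF has_derivative_add[OF assms[THEN has_derivative_dd]]] by simp

lemma dd_scaleR_const:
  assumes "f differentiable (at x)"
  shows "dd (\<lambda>y. c *\<^sub>R f y) x v = c *\<^sub>R dd f x v"
  using dd_eqI[OF has_derivative_scaleR_right[OF has_derivative_dd[OF assms]]] by simp

text \<open>A product rule for a linear map depending on a point, applied to a vector depending on
  the same point. Differentiability is assumed only for fixed arguments, the form available for
  metrics, Christoffel symbols and differentials; the basis expansion extends it to moving
  ones.\<close>

lemma has_derivative_linear_family:
  fixes B :: "'a::real_normed_vector \<Rightarrow> 'b::euclidean_space \<Rightarrow> 'c::real_normed_vector"
  assumes "open S" "x \<in> S" "\<And>y. y \<in> S \<Longrightarrow> linear (B y)"
    and B: "\<And>b. (\<lambda>y. B y b) differentiable (at x)" and W: "(W has_derivative W') (at x)"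
  shows "((\<lambda>y. B y (W y)) has_derivative (\<lambda>v. dd (\<lambda>y. B y (W x)) x v + B x (W' v))) (at x)"
proof -
  have exp: "B y w = (\<Sum>b\<in>Basis. (w \<bullet> b) *\<^sub>R B y b)" if "y \<in> S" for y w
  proof -
    have "B y w = B y (\<Sum>b\<in>Basis. (w \<bullet> b) *\<^sub>R b)" by (simp add: euclidean_representation)
    also have "\<dots> = (\<Sum>b\<in>Basis. (w \<bullet> b) *\<^sub>R B y b)"
      using assms(3)[OF that] by (simp add: linear_sum linear_cmul)
    finally show ?thesis .
  qed
  have "((\<lambda>y. \<Sum>b\<in>Basis. (w \<bullet> b) *\<^sub>R B y b) has_derivative
      (\<lambda>v. \<Sum>b\<in>Basis. (w \<bullet> b) *\<^sub>R dd (\<lambda>y. B y b) x v)) (at x)" for w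
    by (intro has_derivative_sum has_derivative_scaleR_right has_derivative_dd B)
  then have "((\<lambda>y. B y w) has_derivative (\<lambda>v. \<Sum>b\<in>Basis. (w \<bullet> b) *\<^sub>R dd (\<lambda>y. B y b) x v)) (at x)" for w
    by (rule has_derivative_transform_within_open[OF _ assms(1,2)]) (rule exp[symmetric])
  then have 1: "dd (\<lambda>y. B y w) x v = (\<Sum>b\<in>Basis. (w \<bullet> b) *\<^sub>R dd (\<lambda>y. B y b) x v)" for w v
    by (rule dd_eqI[THEN fun_cong])
  have "((\<lambda>y. \<Sum>b\<in>Basis. (W y \<bullet> b) *\<^sub>R B y b) has_derivative
      (\<lambda>v. \<Sum>b\<in>Basis. (W x \<bullet> b) *\<^sub>R dd (\<lambda>y. B y b) x v + (W' v \<bullet> b) *\<^sub>R B x b)) (at x)"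
    by (intro has_derivative_sum has_derivative_scaleR has_derivative_dd B
        bounded_linear.has_derivative[OF bounded_linear_inner_left W])
  then have "((\<lambda>y. B y (W y)) has_derivative
      (\<lambda>v. \<Sum>b\<in>Basis. (W x \<bullet> b) *\<^sub>R dd (\<lambda>y. B y b) x v + (W' v \<bullet> b) *\<^sub>R B x b)) (at x)"
    by (rule has_derivative_transform_within_open[OF _ assms(1,2)]) (rule exp[symmetric])
  then show ?thesis by (simp add: 1[of "W x"] sum.distrib exp[OF assms(2), of "W' _"])
qed

text \<open>Finite-dimensional Riesz representation: positivity makes \<open>?T\<close> injective,
  hence surjective. It justifies the definite description in the Christoffel symbols.\<close>

lemma ex1_representing_vector:
  fixes B :: "'e::euclidean_space \<Rightarrow> 'e \<Rightarrow> real"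
  assumes B: "bilinear B" and pos: "\<And>u. u \<noteq> 0 \<Longrightarrow> 0 < B u u" and l: "linear l"
  shows "\<exists>!y. \<forall>z. B y z = l z"
proof -
  let ?T = "\<lambda>y. \<Sum>b\<in>Basis. B y b *\<^sub>R b"
  have exp: "m z = (\<Sum>b\<in>Basis. (z \<bullet> b) * m b)" if "linear m" for m :: "'e \<Rightarrow> real" and z
  proof -
    have "m z = m (\<Sum>b\<in>Basis. (z \<bullet> b) *\<^sub>R b)" by (simp add: euclidean_representation)
    then show ?thesis using that by (simp add: linear_sum linear_cmul)
  qed
  have lin: "linear (B y)" for y using B by (simp add: bilinear_def)
  have eq0: "y = y'" if "\<And>z. B y z = B y' z" for y y'
  proof (rule ccontr)
    assume "y \<noteq> y'"
    then have "0 < B (y - y') (y - y')" by (intro pos) simp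
    then show False using that by (simp add: bilinear_lsub[OF B])
  qed
  have "linear ?T"
    by (rule linearI)
      (simp_all add: bilinear_ladd[OF B] bilinear_lmul[OF B] scaleR_add_left sum.distrib
        scaleR_sum_right)
  moreover have "inj ?T"
  proof (rule injI)
    fix y y' assume T: "?T y = ?T y'"
    have "B y b = B y' b" if "b \<in> Basis" for b
    proof -
      have "?T y \<bullet> b = ?T y' \<bullet> b" using T by simp
      then show ?thesis using that by simp
    qed
    then have "B y z = B y' z" for z
      by (simp add: exp[OF lin[of y], of z] exp[OF lin[of y'], of z])
    then show "y = y'" by (rule eq0)
  qed
  ultimately have "surj ?T" by (rule linear_injective_imp_surjective) (rule refl)
  then obtain y where y: "?T y = (\<Sum>b\<in>Basis. l b *\<^sub>R b)" using surjD[of ?T] by (metis (no_types))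
  have "B y b = l b" if "b \<in> Basis" for b
  proof -
    have "?T y \<bullet> b = (\<Sum>b\<in>Basis. l b *\<^sub>R b) \<bullet> b" using y by simp
    then show ?thesis using that by simp
  qed
  then have y: "B y z = l z" for z by (simp add: exp[OF lin[of y], of z] exp[OF l, of z])
  show ?thesis
  proof (rule ex1I[of _ y])
    show "y' = y" if "\<forall>z. B y' z = l z" for y'
      by (rule eq0) (simp add: y that)
  qed (simp add: y)
qed

lemma differentiable_vec_nth:
  fixes f :: "'a::real_normed_vector \<Rightarrow> real^'n"
  assumes "\<And>k. (\<lambda>x. f x $ k) differentiable (at a)"
  shows "f differentiable (at a)"
  using assms by (auto simp: differentiable_componentwise_within[of f] Basis_vec_def inner_axis)

lemma differentiable_det:
  fixes A :: "'a::real_normed_vector \<Rightarrow> real^'n^'n"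
  assumes "\<And>i j. (\<lambda>x. A x $ i $ j) differentiable (at a)"
  shows "(\<lambda>x. det (A x)) differentiable (at a)"
proof -
  have "(\<lambda>x. \<Prod>i\<in>UNIV. A x $ i $ p i) differentiable (at a)" for p
    by (rule differentiableI[OF has_derivative_prod]) (rule has_derivative_dd[OF assms])
  then show ?thesis unfolding det_def by (intro differentiable_sum) auto
qed

section \<open>Christoffel symbols and curvature of a metric on an open subset of Euclidean
  space\<close>

definition coord_koszul :: "('e::euclidean_space \<Rightarrow> 'e \<Rightarrow> 'e \<Rightarrow> real) \<Rightarrow> 'e \<Rightarrow> 'e \<Rightarrow> 'e \<Rightarrow> 'e \<Rightarrow> real" where
  "coord_koszul g x v w z =
     (dd (\<lambda>y. g y w z) x v + dd (\<lambda>y. g y v z) x w - dd (\<lambda>y. g y v w) x z) / 2"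

definition coord_christoffel :: "('e::euclidean_space \<Rightarrow> 'e \<Rightarrow> 'e \<Rightarrow> real) \<Rightarrow> 'e \<Rightarrow> 'e \<Rightarrow> 'e \<Rightarrow> 'e" where
  "coord_christoffel g x v w = (THE y. \<forall>z. g x y z = coord_koszul g x v w z)"

definition coord_curvature :: "('e::euclidean_space \<Rightarrow> 'e \<Rightarrow> 'e \<Rightarrow> real) \<Rightarrow> 'e \<Rightarrow> 'e \<Rightarrow> 'e \<Rightarrow> 'e \<Rightarrow> 'e" where
  "coord_curvature g x u v w =
     dd (\<lambda>y. coord_christoffel g y v w) x u - dd (\<lambda>y. coord_christoffel g y u w) x v
     + coord_christoffel g x u (coord_christoffel g x v w)
     - coord_christoffel g x v (coord_christoffel g x u w)"

text \<open>Class C^2 is the regularity for which the curvature makes sense: the Christoffel symbols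
  take one derivative of the metric, and the curvature takes another.\<close>

locale coord_metric =
  fixes U :: "'e::euclidean_space set" and g :: "'e \<Rightarrow> 'e \<Rightarrow> 'e \<Rightarrow> real"
  assumes open_U: "open U"
    and bilinear_g: "x \<in> U \<Longrightarrow> bilinear (g x)"
    and sym_g: "x \<in> U \<Longrightarrow> g x u v = g x v u"
    and pos_g: "x \<in> U \<Longrightarrow> u \<noteq> 0 \<Longrightarrow> 0 < g x u u"
    and C2_g: "Ck_on 2 U (\<lambda>x. g x u v)"
begin

lemma linear_g: "x \<in> U \<Longrightarrow> linear (g x u)"
  and linear_g_left: "x \<in> U \<Longrightarrow> linear (\<lambda>u. g x u v)"
  using bilinear_g by (auto simp: bilinear_def)

lemmas g_algebra =
  bilinear_ladd[OF bilinear_g] bilinear_radd[OF bilinear_g]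
  bilinear_lmul[OF bilinear_g] bilinear_rmul[OF bilinear_g]
  bilinear_lneg[OF bilinear_g] bilinear_rneg[OF bilinear_g]
  bilinear_lsub[OF bilinear_g] bilinear_rsub[OF bilinear_g]
  bilinear_lzero[OF bilinear_g] bilinear_rzero[OF bilinear_g]

lemma g_eqI:
  assumes "x \<in> U" "\<And>z. g x y z = g x y' z"
  shows "y = y'"
proof (rule ccontr)
  assume "y \<noteq> y'"
  then have "0 < g x (y - y') (y - y')" using assms(1) by (intro pos_g) auto
  then show False using assms by (simp add: g_algebra)
qed

lemma differentiable_g: "x \<in> U \<Longrightarrow> (\<lambda>y. g y u v) differentiable (at x)"
  using C2_g[of u v] by (simp add: numeral_2_eq_2)

lemma differentiable_dd_g: "x \<in> U \<Longrightarrow> (\<lambda>y. dd (\<lambda>z. g z u v) y w) differentiable (at x)"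
  using C2_g[of u v] by (simp add: numeral_2_eq_2)

lemma dd_g_add:
  assumes "x \<in> U"
  shows "dd (\<lambda>y. g y u (v + w)) x z = dd (\<lambda>y. g y u v) x z + dd (\<lambda>y. g y u w) x z"
proof -
  have "dd (\<lambda>y. g y u (v + w)) x = dd (\<lambda>y. g y u v + g y u w) x"
    by (rule dd_cong_open[OF open_U assms]) (simp add: g_algebra)
  then show ?thesis using assms by (simp add: dd_add differentiable_g)
qed

lemma dd_g_scaleR:
  assumes "x \<in> U"
  shows "dd (\<lambda>y. g y u (c *\<^sub>R v)) x z = c * dd (\<lambda>y. g y u v) x z"
proof -
  have "dd (\<lambda>y. g y u (c *\<^sub>R v)) x = dd (\<lambda>y. c *\<^sub>R g y u v) x"
    by (rule dd_cong_open[OF open_U assms]) (simp add: g_algebra)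
  then show ?thesis using dd_scaleR_const[OF differentiable_g[OF assms], of c u v z] by simp
qed

lemma dd_g_sym:
  assumes "x \<in> U"
  shows "dd (\<lambda>y. g y u v) x z = dd (\<lambda>y. g y v u) x z"
  using dd_cong_open[OF open_U assms, of "\<lambda>y. g y u v" "\<lambda>y. g y v u"] sym_g by simp

lemma dd_g_zero: "x \<in> U \<Longrightarrow> dd (\<lambda>y. g y u 0) x z = 0" "x \<in> U \<Longrightarrow> dd (\<lambda>y. g y 0 u) x z = 0"
  using dd_g_scaleR[of x u 0 0 z] dd_g_sym[of x u 0 z] by simp_all

lemma linear_dd_g: "x \<in> U \<Longrightarrow> linear (dd (\<lambda>y. g y u v) x)"
  by (intro linear_frechet_derivative differentiable_g)

lemma linear_koszul: "x \<in> U \<Longrightarrow> linear (coord_koszul g x v w)"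
  unfolding coord_koszul_def
  by (rule linearI)
    (simp_all add: dd_g_add dd_g_scaleR linear_add[OF linear_dd_g] linear_cmul[OF linear_dd_g]
      field_simps)

lemma christoffel_eq:
  assumes "x \<in> U"
  shows "g x (coord_christoffel g x v w) z = coord_koszul g x v w z"
  using theI'[OF ex1_representing_vector[OF bilinear_g[OF assms] pos_g[OF assms]
      linear_koszul[OF assms, of v w]]]
  unfolding coord_christoffel_def by blast

lemma christoffel_sym:
  assumes "x \<in> U"
  shows "coord_christoffel g x v w = coord_christoffel g x w v"
  by (rule g_eqI[OF assms])
    (simp add: christoffel_eq[OF assms] coord_koszul_def dd_g_sym[OF assms, of v w])

lemma linear_christoffel:
  assumes "x \<in> U"
  shows "linear (coord_christoffel g x v)"
proof (rule linearI)
  have add1: "dd (\<lambda>y. g y (u + w) v) x z = dd (\<lambda>y. g y u v) x z + dd (\<lambda>y. g y w v) x z" for u w v z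
    using dd_g_add[OF assms, of v u w z] by (simp add: dd_g_sym[OF assms, of _ v])
  have scale1: "dd (\<lambda>y. g y (c *\<^sub>R u) v) x z = c * dd (\<lambda>y. g y u v) x z" for c u v z
    using dd_g_scaleR[OF assms, of v c u z] by (simp add: dd_g_sym[OF assms, of _ v])
  show "coord_christoffel g x v (u + w) = coord_christoffel g x v u + coord_christoffel g x v w" for u w
    by (rule g_eqI[OF assms])
      (simp add: assms g_algebra christoffel_eq coord_koszul_def add1 dd_g_add
        linear_add[OF linear_dd_g] field_simps)
  show "coord_christoffel g x v (c *\<^sub>R u) = c *\<^sub>R coord_christoffel g x v u" for c u
    by (rule g_eqI[OF assms])
      (simp add: assms g_algebra christoffel_eq coord_koszul_def scale1 dd_g_scaleR
        linear_cmul[OF linear_dd_g] field_simps)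
qed

end

text \<open>The definite description hides how the vector depends on the base point. In the standard
  basis the defining condition is a linear system with the Gram matrix \<open>A y\<close> and right
  side \<open>c y\<close>, and Cramer's rule gives each component as a quotient of determinants of
  differentiable entries.\<close>

lemma differentiable_christoffel:
  fixes g :: "real^'n \<Rightarrow> real^'n \<Rightarrow> real^'n \<Rightarrow> real"
  assumes "coord_metric U g" and x: "x \<in> U"
  shows "(\<lambda>y. coord_christoffel g y v w) differentiable (at x)"
proof -
  interpret coord_metric U g by fact
  define A :: "real^'n \<Rightarrow> real^'n^'n" where "A y = (\<chi> i j. g y (axis j 1) (axis i 1))" for y
  define c :: "real^'n \<Rightarrow> real^'n" where "c y = (\<chi> i. coord_koszul g y v w (axis i 1))" for y
  have Av: "(A y *v z) $ i = g y z (axis i 1)" if "y \<in> U" for y z i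
  proof -
    have "g y z (axis i 1) = g y (\<Sum>j\<in>UNIV. (z $ j) *\<^sub>R axis j 1) (axis i 1)"
      using basis_expansion[of z] by (simp add: scalar_mult_eq_scaleR)
    also have "\<dots> = (\<Sum>j\<in>UNIV. z $ j * g y (axis j 1) (axis i 1))"
      by (subst linear_sum[OF linear_g_left[OF that]]) (simp add: g_algebra that)
    finally show ?thesis by (simp add: A_def matrix_vector_mult_def mult.commute)
  qed
  have det: "det (A y) \<noteq> 0" if "y \<in> U" for y
  proof -
    \<comment> \<open>A kernel vector of the Gram matrix has g(z, z) = 0, so positivity makes the
      matrix invertible.\<close>
    have "z = 0" if z: "A y *v z = 0" for z
    proof -
      have "g y z z = g y z (\<Sum>i\<in>UNIV. (z $ i) *\<^sub>R axis i 1)"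
        using basis_expansion[of z] by (simp add: scalar_mult_eq_scaleR)
      also have "\<dots> = (\<Sum>i\<in>UNIV. z $ i * (A y *v z) $ i)"
        using linear_g[OF \<open>y \<in> U\<close>] by (simp add: linear_sum linear_cmul Av[OF \<open>y \<in> U\<close>])
      also have "\<dots> = 0" by (simp add: z)
      finally show "z = 0" using pos_g[OF \<open>y \<in> U\<close>, of z] by fastforce
    qed
    then have "invertible (A y)" by (simp add: invertible_left_inverse matrix_left_invertible_ker)
    then show ?thesis by (simp add: invertible_det_nz)
  qed
  let ?C = "\<lambda>k y. det (\<chi> i j. if j = k then c y $ i else A y $ i $ j) / det (A y)"
  have dA: "(\<lambda>y. A y $ i $ j) differentiable (at x)" for i j
    by (simp add: A_def differentiable_g[OF x])
  have dc: "(\<lambda>y. c y $ i) differentiable (at x)" for i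
    by (simp add: c_def coord_koszul_def differentiable_dd_g[OF x])
  have "?C k differentiable (at x)" for k
  proof (intro differentiable_divide differentiable_det)
    show "(\<lambda>y. (\<chi> i j. if j = k then c y $ i else A y $ i $ j) $ i $ j) differentiable (at x)" for i j
      by (cases "j = k") (simp_all add: dA dc)
  qed (use dA det x in auto)
  then have "(\<lambda>y. \<chi> k. ?C k y) differentiable (at x)"
    by (intro differentiable_vec_nth) simp
  moreover have "(\<chi> k. ?C k y) = coord_christoffel g y v w" if "y \<in> U" for y
  proof -
    have "A y *v coord_christoffel g y v w = c y"
      using that by (simp add: vec_eq_iff Av c_def christoffel_eq)
    then show ?thesis using cramer[OF det[OF that]] by simp
  qed
  ultimately show ?thesis by (rule differentiable_cong_open[OF open_U x, rotated])
qed

section \<open>Closed conformal fields on a warped product\<close>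

text \<open>The product rule of linear families, once in each argument. The base point moves along a
  map \<open>F\<close>, because under an isometry the target metric is evaluated at the image
  point.\<close>

lemma has_derivative_bilinear_family:
  fixes B :: "'z::real_normed_vector \<Rightarrow> 'b::euclidean_space \<Rightarrow> 'b \<Rightarrow> real"
  assumes "open T" "x \<in> T" and bil: "\<And>y. y \<in> T \<Longrightarrow> bilinear (B (F y))"
    and B: "\<And>u v. (\<lambda>z. B z u v) differentiable (at (F x))"
    and F: "(F has_derivative F') (at x)"
    and X: "(X has_derivative X') (at x)" and Y: "(Y has_derivative Y') (at x)"
  shows "((\<lambda>y. B (F y) (X y) (Y y)) has_derivative
    (\<lambda>\<xi>. dd (\<lambda>z. B z (X x) (Y x)) (F x) (F' \<xi>) + B (F x) (X' \<xi>) (Y x) + B (F x) (X x) (Y' \<xi>))) (at x)"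
proof -
  have FB: "((\<lambda>y. B (F y) u v) has_derivative (\<lambda>\<xi>. dd (\<lambda>z. B z u v) (F x) (F' \<xi>))) (at x)" for u v
    using has_derivative_compose[OF F has_derivative_dd[OF B]] .
  have 1: "((\<lambda>y. B (F y) u (Y y)) has_derivative
      (\<lambda>\<xi>. dd (\<lambda>y. B (F y) u (Y x)) x \<xi> + B (F x) u (Y' \<xi>))) (at x)" for u
    by (rule has_derivative_linear_family[OF assms(1,2) _ _ Y])
      (use bil in \<open>auto simp: bilinear_def intro: differentiableI[OF FB]\<close>)
  have "((\<lambda>y. (\<lambda>u. B (F y) u (Y y)) (X y)) has_derivative
      (\<lambda>\<xi>. dd (\<lambda>y. (\<lambda>u. B (F y) u (Y y)) (X x)) x \<xi> + (\<lambda>u. B (F x) u (Y x)) (X' \<xi>))) (at x)"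
    by (rule has_derivative_linear_family[OF assms(1,2) _ _ X])
      (use bil in \<open>auto simp: bilinear_def intro: differentiableI[OF 1]\<close>)
  then show ?thesis by (simp add: dd_eqI[OF 1] dd_eqI[OF FB] algebra_simps)
qed

section \<open>The warped metric and its closed conformal fields in a product chart\<close>

definition warped_metric :: "(real \<Rightarrow> real) \<Rightarrow> ('e::real_vector \<Rightarrow> 'e \<Rightarrow> 'e \<Rightarrow> real) \<Rightarrow>
    real \<times> 'e \<Rightarrow> real \<times> 'e \<Rightarrow> real \<times> 'e \<Rightarrow> real" where
  "warped_metric f g z u v = - (fst u * fst v) + (f (fst z))\<^sup>2 * g (snd z) (snd u) (snd v)"

locale warped_coord = coord_metric U g for U :: "'e::euclidean_space set" and g +
  fixes I :: "real set" and f f' :: "real \<Rightarrow> real"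
  assumes open_I: "open I"
    and f_deriv: "t \<in> I \<Longrightarrow> (f has_real_derivative f' t) (at t)"
    and f_pos: "t \<in> I \<Longrightarrow> 0 < f t"
begin

abbreviation "G \<equiv> warped_metric f g"

lemma bilinear_G: "z \<in> I \<times> U \<Longrightarrow> bilinear (G z)"
  unfolding bilinear_def warped_metric_def
  by (auto intro!: linearI simp: g_algebra algebra_simps)

lemma sym_G: "z \<in> I \<times> U \<Longrightarrow> G z u v = G z v u"
  unfolding warped_metric_def using sym_g by (auto simp: mult.commute)

lemma has_derivative_G:
  assumes "z \<in> I \<times> U"
  shows "((\<lambda>z. G z u v) has_derivative (\<lambda>\<xi>. 2 * f (fst z) * f' (fst z) * fst \<xi> * g (snd z) (snd u) (snd v)
    + (f (fst z))\<^sup>2 * dd (\<lambda>x. g x (snd u) (snd v)) (snd z) (snd \<xi>))) (at z)"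
proof -
  have x: "snd z \<in> U" and t: "fst z \<in> I" using assms by auto
  have 1: "((\<lambda>z. f (fst z)) has_derivative (\<lambda>\<xi>. f' (fst z) * fst \<xi>)) (at z)"
    using has_derivative_compose[OF has_derivative_fst[OF has_derivative_ident]
        f_deriv[OF t, THEN has_field_derivative_imp_has_derivative]] by simp
  have 2: "((\<lambda>z. g (snd z) (snd u) (snd v)) has_derivative
      (\<lambda>\<xi>. dd (\<lambda>x. g x (snd u) (snd v)) (snd z) (snd \<xi>))) (at z)"
    using has_derivative_compose[OF has_derivative_snd[OF has_derivative_ident]
        has_derivative_dd[OF differentiable_g[OF x]]] by simp
  show ?thesis
    unfolding warped_metric_def
    by (rule derivative_eq_intros 1 2 refl)+ (simp add: algebra_simps)
qed

lemmas dd_G = dd_eqI[OF has_derivative_G, THEN fun_cong]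

lemma has_derivative_G_moving:
  assumes "open T" "x \<in> T" "F ` T \<subseteq> I \<times> U" "(F has_derivative F') (at x)"
    "(X has_derivative X') (at x)" "(Y has_derivative Y') (at x)"
  shows "((\<lambda>y. G (F y) (X y) (Y y)) has_derivative
    (\<lambda>\<xi>. dd (\<lambda>z. G z (X x) (Y x)) (F x) (F' \<xi>) + G (F x) (X' \<xi>) (Y x) + G (F x) (X x) (Y' \<xi>))) (at x)"
  by (rule has_derivative_bilinear_family[OF assms(1,2) _ _ assms(4-)])
    (use assms in \<open>auto intro!: bilinear_G differentiableI[OF has_derivative_G] simp: image_subset_iff\<close>)

end

text \<open>One chart's worth of the hypotheses on \<open>V\<close>. The field is of class C^2
  because the first order equations obtained from it are differentiated once more, and
  \<open>f''\<close> enters through the same differentiation.\<close>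

locale warped_closed_conformal = warped_coord U g I f f'
  for U :: "(real^'n) set" and g I f f' +
  fixes f'' :: "real \<Rightarrow> real" and Q :: "(real \<times> (real^'n)) set" and V :: "real \<times> (real^'n) \<Rightarrow> real \<times> (real^'n)"
  assumes f'_deriv: "t \<in> I \<Longrightarrow> (f' has_real_derivative f'' t) (at t)"
    and open_Q: "open Q" and Q_subset: "Q \<subseteq> I \<times> U"
    and C2_V: "Ck_on 2 Q V"
    and conformal_V: "z \<in> Q \<Longrightarrow> \<exists>a. \<forall>u v. dd (\<lambda>z. G z u v) z (V z) + G z (dd V z u) v + G z u (dd V z v)
      = 2 * a * G z u v"
    and closed_V: "z \<in> Q \<Longrightarrow> dd (\<lambda>z. G z (V z) v) z u = dd (\<lambda>z. G z (V z) u) z v"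
begin

abbreviation "\<phi> z \<equiv> fst (V z)"
abbreviation "W z \<equiv> snd (V z)"
abbreviation "e0 \<equiv> (1::real, 0 :: real^'n)"

lemma fst_snd_Q: "z \<in> Q \<Longrightarrow> fst z \<in> I" "z \<in> Q \<Longrightarrow> snd z \<in> U"
  using Q_subset by auto

lemma V_deriv: "z \<in> Q \<Longrightarrow> (V has_derivative dd V z) (at z)"
  using Ck_on_has_derivative[of 1 Q V] C2_V by (simp only: numeral_2_eq_2 One_nat_def)

lemma dd_V_deriv: "z \<in> Q \<Longrightarrow> ((\<lambda>z. dd V z u) has_derivative dd (\<lambda>z. dd V z u) z) (at z)"
  using Ck_on_has_derivative[OF Ck_on_dd] C2_V by (simp only: numeral_2_eq_2)

lemma dd_G_V:
  assumes "z \<in> Q"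
  shows "dd (\<lambda>z. G z (V z) v) z u = dd (\<lambda>y. G y (V z) v) z u + G z (dd V z u) v"
proof -
  have z: "z \<in> I \<times> U" using assms Q_subset by auto
  have "((\<lambda>y. G y (V y) v) has_derivative
    (\<lambda>\<xi>. dd (\<lambda>y. G y (V z) v) z \<xi> + G z (dd V z \<xi>) v + G z (V z) 0)) (at z)"
    using has_derivative_G_moving[OF open_Q assms, of "\<lambda>y. y" "\<lambda>y. y" V "dd V z" "\<lambda>y. v" "\<lambda>y. 0"]
      Q_subset V_deriv[OF assms] by simp
  from dd_eqI[OF this] show ?thesis by (simp add: bilinear_rzero[OF bilinear_G[OF z]])
qed

text \<open>The conformal equation and closedness are evaluated on the pairs (time, time), (time,
  space) and (space, space). The first pair identifies the conformal factor with
  \<partial>\<phi>/\<partial>t, the mixed pair gives the two equations linking \<phi> and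
  \<open>W\<close>, and the spatial pair gives the equation inside the slice.\<close>

lemma first_order:
  assumes z: "z \<in> Q"
  shows W_time: "snd (dd V z e0) = - (f' (fst z) / f (fst z)) *\<^sub>R W z"
    and \<phi>_space: "fst (dd V z (0, v)) = - f (fst z) * f' (fst z) * g (snd z) (W z) v"
    and W_space: "snd (dd V z (0, v)) + coord_christoffel g (snd z) v (W z)
      = (fst (dd V z e0) - \<phi> z * f' (fst z) / f (fst z)) *\<^sub>R v"
proof -
  obtain t x where zt: "z = (t, x)" by (cases z)
  have x: "x \<in> U" and t: "t \<in> I" using fst_snd_Q[OF z] zt by auto
  have zI: "z \<in> I \<times> U" using z Q_subset by auto
  have f: "f t > 0" using f_pos t .
  obtain a where a: "\<And>u v. dd (\<lambda>z. G z u v) z (V z) + G z (dd V z u) v + G z u (dd V z v) = 2 * a * G z u v"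
    using conformal_V[OF z] by blast
  note a = a[unfolded dd_G[OF zI]]
  have cl: "dd (\<lambda>y. G y (V z) v) z u + G z (dd V z u) v = dd (\<lambda>y. G y (V z) u) z v + G z (dd V z v) u" for u v
    using closed_V[OF z, of v u] by (simp add: dd_G_V[OF z])
  note cl = cl[unfolded dd_G[OF zI]]
  note Gs = warped_metric_def zt g_algebra[OF x] dd_g_zero[OF x] linear_0[OF linear_dd_g[OF x]]
  have a1: "fst (dd V z e0) = a"
    using a[of e0 e0] by (simp add: Gs)
  have a2: "(f t)\<^sup>2 * g x (snd (dd V z e0)) v = fst (dd V z (0, v))" for v
    using a[of e0 "(0, v)"] by (simp add: Gs)
  have a3: "2 * f t * f' t * \<phi> z * g x u v + (f t)\<^sup>2 * dd (\<lambda>x. g x u v) x (W z)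
      + (f t)\<^sup>2 * g x (snd (dd V z (0, u))) v + (f t)\<^sup>2 * g x u (snd (dd V z (0, v)))
      = 2 * a * (f t)\<^sup>2 * g x u v" for u v
    using a[of "(0, u)" "(0, v)"] by (simp add: Gs algebra_simps)
  have c1: "2 * f t * f' t * g x (W z) v + (f t)\<^sup>2 * g x (snd (dd V z e0)) v
      = - fst (dd V z (0, v))" for v
    using cl[of e0 "(0, v)"] by (simp add: Gs)
  have c2: "(f t)\<^sup>2 * dd (\<lambda>y. g y (W z) v) x u + (f t)\<^sup>2 * g x (snd (dd V z (0, u))) v
      = (f t)\<^sup>2 * dd (\<lambda>y. g y (W z) u) x v + (f t)\<^sup>2 * g x (snd (dd V z (0, v))) u" for u v
    using cl[of "(0, u)" "(0, v)"] by (simp add: Gs)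
  \<comment> \<open>The mixed components \<open>a2\<close> and \<open>c1\<close> are two linear
    equations for the same two quantities, the time derivative of \<open>W\<close> (lowered with f^2
    g) and the space derivative of \<phi>. They force both to equal - f f' g(W, v).\<close>
  have ff: "(f t)\<^sup>2 * g x (snd (dd V z e0)) v = - f t * f' t * g x (W z) v" for v
    using a2[of v] c1[of v] by simp
  show "fst (dd V z (0, v)) = - f (fst z) * f' (fst z) * g (snd z) (W z) v"
    using a2[of v] ff[of v] zt by simp
  show "snd (dd V z e0) = - (f' (fst z) / f (fst z)) *\<^sub>R W z"
  proof (rule g_eqI[OF x])
    fix v
    have "f t * (f t * g x (snd (dd V z e0)) v + f' t * g x (W z) v) = 0"
      using ff[of v] by (simp add: power2_eq_square algebra_simps)
    then have "f t * g x (snd (dd V z e0)) v = - f' t * g x (W z) v" using f by simp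
    then show "g x (snd (dd V z e0)) v = g x (- (f' (fst z) / f (fst z)) *\<^sub>R W z) v"
      using f zt by (simp add: g_algebra x field_simps)
  qed
  \<comment> \<open>Closedness replaces g(u, dW v) in the conformal equation by g(dW u, v) and
    derivatives of the metric. The derivative terms then assemble into twice the Koszul expression
    for (u, W), so this is twice the lowered covariant derivative.\<close>
  have d: "2 * g x (snd (dd V z (0, u))) v + dd (\<lambda>y. g y (W z) v) x u + dd (\<lambda>x. g x u v) x (W z)
      - dd (\<lambda>y. g y (W z) u) x v = 2 * (a - \<phi> z * f' t / f t) * g x u v" for u v
  proof -
    let ?A = "dd (\<lambda>x. g x u v) x (W z) + g x (snd (dd V z (0, u))) v + g x u (snd (dd V z (0, v)))"
    have "f t * (2 * f' t * \<phi> z * g x u v + f t * ?A) = f t * (2 * a * f t * g x u v)"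
      using a3[of u v] by (simp add: power2_eq_square algebra_simps)
    then have "2 * f' t * \<phi> z * g x u v + f t * ?A = 2 * a * f t * g x u v" using f by simp
    then have 1: "?A = 2 * (a - \<phi> z * f' t / f t) * g x u v" using f by (simp add: field_simps)
    have "(f t)\<^sup>2 * (dd (\<lambda>y. g y (W z) v) x u + g x (snd (dd V z (0, u))) v)
      = (f t)\<^sup>2 * (dd (\<lambda>y. g y (W z) u) x v + g x (snd (dd V z (0, v))) u)"
      using c2[of v u] by (simp add: algebra_simps)
    then have "dd (\<lambda>y. g y (W z) v) x u + g x (snd (dd V z (0, u))) v
      = dd (\<lambda>y. g y (W z) u) x v + g x (snd (dd V z (0, v))) u" using f by simp
    then show ?thesis using 1 sym_g[OF x, of u "snd (dd V z (0, v))"] by simp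
  qed
  show "snd (dd V z (0, v)) + coord_christoffel g (snd z) v (W z)
      = (fst (dd V z e0) - \<phi> z * f' (fst z) / f (fst z)) *\<^sub>R v"
  proof (rule g_eqI[OF x])
    fix w
    show "g x (snd (dd V z (0, v)) + coord_christoffel g (snd z) v (W z)) w
      = g x ((fst (dd V z e0) - \<phi> z * f' (fst z) / f (fst z)) *\<^sub>R v) w"
      using d[of v w] dd_g_sym[OF x, of v "W z" w]
      by (simp add: g_algebra x christoffel_eq coord_koszul_def a1[unfolded zt] zt field_simps)
  qed
qed

definition "b z = fst (dd V z e0) - \<phi> z * f' (fst z) / f (fst z)"

text \<open>\<open>b\<close> contains the time derivative of \<phi>, about which the first order
  equations say nothing. Its space derivative is accessible after exchanging the two derivatives,
  since the space derivative of \<phi> is known in terms of \<open>W\<close> along all of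
  \<open>Q\<close>.\<close>

lemma b_deriv:
  assumes z: "z \<in> Q"
  shows "(b has_derivative dd b z) (at z)"
    and "dd b z (0, u) = ((f' (fst z))\<^sup>2 - f (fst z) * f'' (fst z)) * g (snd z) (W z) u"
proof -
  have t: "fst z \<in> I" and x: "snd z \<in> U" using fst_snd_Q[OF z] by auto
  have f: "f (fst z) > 0" using f_pos t .
  have df: "((\<lambda>z. f (fst z)) has_derivative (\<lambda>\<xi>. f' (fst z) * fst \<xi>)) (at z)"
    using has_derivative_compose[OF has_derivative_fst[OF has_derivative_ident]
        f_deriv[OF t, THEN has_field_derivative_imp_has_derivative]] by simp
  have df': "((\<lambda>z. f' (fst z)) has_derivative (\<lambda>\<xi>. f'' (fst z) * fst \<xi>)) (at z)"
    using has_derivative_compose[OF has_derivative_fst[OF has_derivative_ident]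
        f'_deriv[OF t, THEN has_field_derivative_imp_has_derivative]] by simp
  note dV = V_deriv[OF z] and ddV = dd_V_deriv[OF z]
  have db: "(b has_derivative (\<lambda>\<xi>. fst (dd (\<lambda>z. dd V z e0) z \<xi>)
      - ((fst (dd V z \<xi>) * f' (fst z) + \<phi> z * (f'' (fst z) * fst \<xi>)) * f (fst z)
          - \<phi> z * f' (fst z) * (f' (fst z) * fst \<xi>)) / (f (fst z) * f (fst z)))) (at z)"
    unfolding b_def
    apply (rule has_derivative_diff)
     apply (rule has_derivative_fst[OF ddV])
    apply (rule has_derivative_eq_rhs)
     apply (rule has_derivative_divide'[OF has_derivative_mult[OF has_derivative_fst[OF dV] df'] df])
    using f apply simp
    using f by (simp add: algebra_simps)
  then show "(b has_derivative dd b z) (at z)" by (simp add: dd_eqI)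
  have "dd (\<lambda>z. dd V z e0) z (0, u) = dd (\<lambda>z. dd V z (0, u)) z e0"
    by (rule dd_commute[OF open_Q z C2_V])
  moreover have "fst (dd (\<lambda>z. dd V z (0, u)) z e0)
      = - ((f' (fst z))\<^sup>2 + f (fst z) * f'' (fst z)) * g (snd z) (W z) u
        - f (fst z) * f' (fst z) * g (snd z) (snd (dd V z e0)) u"
  proof -
    have gW: "((\<lambda>z. g (snd z) (W z) u) has_derivative (\<lambda>\<xi>. dd (\<lambda>x. g x (W z) u) (snd z) (snd \<xi>)
        + g (snd z) (snd (dd V z \<xi>)) u + g (snd z) (W z) 0)) (at z)"
    proof (rule has_derivative_bilinear_family[OF open_Q z])
      show "bilinear (g (snd y))" if "y \<in> Q" for y using bilinear_g fst_snd_Q that by blast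
      show "(\<lambda>x. g x u v) differentiable (at (snd z))" for u v by (rule differentiable_g[OF x])
    qed (auto intro!: derivative_intros dV)
    have "((\<lambda>z. - f (fst z) * f' (fst z) * g (snd z) (W z) u) has_derivative
       (\<lambda>\<xi>. - f (fst z) * f' (fst z) * (dd (\<lambda>x. g x (W z) u) (snd z) (snd \<xi>)
        + g (snd z) (snd (dd V z \<xi>)) u + g (snd z) (W z) 0)
        + (- f (fst z) * (f'' (fst z) * fst \<xi>) + - (f' (fst z) * fst \<xi>) * f' (fst z)) * g (snd z) (W z) u)) (at z)"
      by (intro has_derivative_mult has_derivative_minus df df' gW)
    then have "((\<lambda>z. fst (dd V z (0, u))) has_derivative
       (\<lambda>\<xi>. - f (fst z) * f' (fst z) * (dd (\<lambda>x. g x (W z) u) (snd z) (snd \<xi>)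
        + g (snd z) (snd (dd V z \<xi>)) u + g (snd z) (W z) 0)
        + (- f (fst z) * (f'' (fst z) * fst \<xi>) + - (f' (fst z) * fst \<xi>) * f' (fst z)) * g (snd z) (W z) u)) (at z)"
      by (rule has_derivative_transform_within_open[OF _ open_Q z]) (simp add: \<phi>_space)
    from has_derivative_unique[OF has_derivative_fst[OF ddV] this]
    have "fst (dd (\<lambda>z. dd V z (0, u)) z e0) = - f (fst z) * f' (fst z) * (dd (\<lambda>x. g x (W z) u) (snd z) (snd e0)
        + g (snd z) (snd (dd V z e0)) u + g (snd z) (W z) 0)
        + (- f (fst z) * (f'' (fst z) * fst e0) + - (f' (fst z) * fst e0) * f' (fst z)) * g (snd z) (W z) u"
      by (rule fun_cong)
    then show ?thesis
      by (simp add: g_algebra x linear_0[OF linear_dd_g[OF x]] power2_eq_square algebra_simps)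
  qed
  moreover have "g (snd z) (snd (dd V z e0)) u = - f' (fst z) / f (fst z) * g (snd z) (W z) u"
    by (simp add: W_time[OF z] g_algebra x)
  \<comment> \<open>The f'^2 term from differentiating the factor f f' is cancelled by the one from
    the time derivative of \<open>W\<close>; only - f f'' survives here. The f'^2 in the final
    formula comes from the quotient \<phi> f'/f.\<close>
  ultimately have "fst (dd (\<lambda>z. dd V z e0) z (0, u)) = - f (fst z) * f'' (fst z) * g (snd z) (W z) u"
    using f by (simp add: power2_eq_square field_simps)
  moreover have "dd b z (0, u) = fst (dd (\<lambda>z. dd V z e0) z (0, u)) - fst (dd V z (0, u)) * f' (fst z) / f (fst z)"
    using f by (simp add: dd_eqI[OF db])
  ultimately show "dd b z (0, u) = ((f' (fst z))\<^sup>2 - f (fst z) * f'' (fst z)) * g (snd z) (W z) u"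
    using f by (simp add: \<phi>_space[OF z] power2_eq_square field_simps)
qed

text \<open>The curvature is built from coordinate-constant fields, so \<open>W\<close> is frozen at
  its value \<open>?w\<close>; what is lost by freezing reappears as the Christoffel symbol applied
  to the derivative of \<open>W\<close>. The result is the Ricci identity for a field with covariant
  derivative b times the identity.\<close>

lemma curvature_W:
  assumes z: "z \<in> Q" and u: "g (snd z) u (W z) = 0"
  shows "g (snd z) (coord_curvature g (snd z) u (W z) (W z)) u
    = - ((f' (fst z))\<^sup>2 - f (fst z) * f'' (fst z)) * g (snd z) (W z) (W z) * g (snd z) u u"
proof -
  have x: "snd z \<in> U" using fst_snd_Q[OF z] by auto
  let ?w = "W z" and ?\<Gamma> = "coord_christoffel g (snd z)"
  have E: "snd (dd (\<lambda>z. dd V z (0, u)) z (0, v)) + dd (\<lambda>x. coord_christoffel g x u ?w) (snd z) v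
      + ?\<Gamma> u (snd (dd V z (0, v))) = dd b z (0, v) *\<^sub>R u" for u v
  proof -
    have d\<Gamma>: "((\<lambda>z. coord_christoffel g (snd z) u w) has_derivative
        (\<lambda>\<xi>. dd (\<lambda>x. coord_christoffel g x u w) (snd z) (snd \<xi>))) (at z)" for w
      using has_derivative_compose[OF has_derivative_snd[OF has_derivative_ident]
        has_derivative_dd[OF differentiable_christoffel[OF coord_metric_axioms x]]] by simp
    have "((\<lambda>z. coord_christoffel g (snd z) u (W z)) has_derivative
        (\<lambda>\<xi>. dd (\<lambda>z. coord_christoffel g (snd z) u ?w) z \<xi> + ?\<Gamma> u (snd (dd V z \<xi>)))) (at z)"
    proof (rule has_derivative_linear_family[OF open_Q z])
      show "linear (coord_christoffel g (snd y) u)" if "y \<in> Q" for y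
        using linear_christoffel fst_snd_Q that by blast
    qed (auto intro!: has_derivative_snd V_deriv z differentiableI[OF d\<Gamma>])
    then have "((\<lambda>z. snd (dd V z (0, u)) + coord_christoffel g (snd z) u (W z)) has_derivative
        (\<lambda>\<xi>. snd (dd (\<lambda>z. dd V z (0, u)) z \<xi>) + (dd (\<lambda>x. coord_christoffel g x u ?w) (snd z) (snd \<xi>)
          + ?\<Gamma> u (snd (dd V z \<xi>))))) (at z)"
      unfolding dd_eqI[OF d\<Gamma>]
      by (intro has_derivative_add has_derivative_snd dd_V_deriv z)
    then have "((\<lambda>z. b z *\<^sub>R u) has_derivative
        (\<lambda>\<xi>. snd (dd (\<lambda>z. dd V z (0, u)) z \<xi>) + (dd (\<lambda>x. coord_christoffel g x u ?w) (snd z) (snd \<xi>)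
          + ?\<Gamma> u (snd (dd V z \<xi>))))) (at z)"
      by (rule has_derivative_transform_within_open[OF _ open_Q z]) (simp add: W_space b_def)
    from has_derivative_unique[OF this has_derivative_scaleR_left[OF b_deriv(1)[OF z]]]
    have "snd (dd (\<lambda>z. dd V z (0, u)) z (0, v)) + (dd (\<lambda>x. coord_christoffel g x u ?w) (snd z) (snd (0::real, v))
          + ?\<Gamma> u (snd (dd V z (0, v)))) = dd b z (0, v) *\<^sub>R u"
      by (rule fun_cong)
    then show ?thesis by (simp add: add.assoc)
  qed
  \<comment> \<open>Inserting the first order equation for the derivative of \<open>W\<close> into
    \<open>E\<close> produces the products of Christoffel symbols that occur in the
    curvature.\<close>
  have Wsp: "snd (dd V z (0, v)) = b z *\<^sub>R v - ?\<Gamma> v ?w" for v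
    using W_space[OF z, of v] by (simp add: b_def algebra_simps)
  have comm: "dd (\<lambda>z. dd V z (0, u)) z (0, ?w) = dd (\<lambda>z. dd V z (0, ?w)) z (0, u)"
    by (rule dd_commute[OF open_Q z C2_V])
  note lin = linear_christoffel[OF x]
  let ?S = "snd (dd (\<lambda>z. dd V z (0, ?w)) z (0, u))"
  \<comment> \<open>Equations \<open>1\<close> and \<open>2\<close> share the second derivative
    \<open>?S\<close> and the term with \<open>b z\<close>. Both drop out of the difference, and the
    products of Christoffel symbols cancel against those in \<open>coord_curvature\<close>.\<close>
  have 1: "dd (\<lambda>x. coord_christoffel g x ?w ?w) (snd z) u
      = dd b z (0, u) *\<^sub>R ?w - ?S - b z *\<^sub>R ?\<Gamma> u ?w + ?\<Gamma> ?w (?\<Gamma> u ?w)"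
    using E[of ?w u] unfolding Wsp
    by (simp add: linear_diff[OF lin] linear_cmul[OF lin] christoffel_sym[OF x, of ?w u] algebra_simps)
  have 2: "dd (\<lambda>x. coord_christoffel g x u ?w) (snd z) ?w
      = dd b z (0, ?w) *\<^sub>R u - ?S - b z *\<^sub>R ?\<Gamma> u ?w + ?\<Gamma> u (?\<Gamma> ?w ?w)"
    using E[of u ?w] unfolding Wsp comm
    by (simp add: linear_diff[OF lin] linear_cmul[OF lin] algebra_simps)
  have "coord_curvature g (snd z) u ?w ?w = dd b z (0, u) *\<^sub>R ?w - dd b z (0, ?w) *\<^sub>R u"
    unfolding coord_curvature_def 1 2 by simp
  then show ?thesis
    using u sym_g[OF x, of u ?w] by (simp add: g_algebra x b_deriv(2)[OF z] left_diff_distrib)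
qed

lemma W_eq_0:
  assumes n: "2 \<le> CARD('n)"
    and curv: "\<And>x u v. x \<in> U \<Longrightarrow> u \<noteq> v \<Longrightarrow> independent {u, v} \<Longrightarrow>
      g x (coord_curvature g x u v v) u / (g x u u * g x v v - (g x u v)\<^sup>2) = k"
    and nondeg: "\<And>t. t \<in> I \<Longrightarrow> (f' t)\<^sup>2 + k - f t * f'' t \<noteq> 0"
    and z: "z \<in> Q"
  shows "W z = 0"
proof (rule ccontr)
  assume W0: "W z \<noteq> 0"
  have t: "fst z \<in> I" and x: "snd z \<in> U" using fst_snd_Q[OF z] by auto
  let ?g = "g (snd z)"
  obtain i j :: 'n where ij: "i \<noteq> j"
  proof -
    have "\<not> CARD('n) \<le> Suc 0" using n by simp
    then show ?thesis using that by (metis card_le_Suc0_iff_eq finite_code UNIV_I)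
  qed
  let ?a = "?g (axis i 1) (W z)" and ?b = "?g (axis j 1) (W z)"
  \<comment> \<open>A nonzero vector orthogonal to \<open>W\<close>: an axis if it happens to be
    orthogonal, otherwise the combination of two axes that eliminates the component along
    \<open>W\<close>. This is where the slice must have dimension at least two.\<close>
  define u :: "real^'n" where "u = (if ?a = 0 then axis i 1 else ?b *\<^sub>R axis i 1 - ?a *\<^sub>R axis j 1)"
  have uW: "?g u (W z) = 0" by (simp add: u_def g_algebra x)
  have u0: "u \<noteq> 0"
  proof (cases "?a = 0")
    case True
    then show ?thesis by (simp add: u_def axis_eq_0_iff)
  next
    case False
    have "u $ j = - ?a" using False ij by (simp add: u_def axis_def)
    then show ?thesis using False by auto
  qed
  have indep: "independent {u, W z}" and neq: "u \<noteq> W z"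
  proof -
    have pos: "0 < ?g u u" using pos_g[OF x u0] .
    then show "u \<noteq> W z" using uW by auto
    have "u \<notin> span {W z}"
    proof
      assume "u \<in> span {W z}"
      then obtain c where "u = c *\<^sub>R W z" by (auto simp: span_singleton)
      then have "?g u u = c * ?g u (W z)" by (metis bilinear_g[OF x] bilinear_rmul real_scaleR_def)
      then show False using pos uW by simp
    qed
    then show "independent {u, W z}" using W0 by (simp add: independent_insert)
  qed
  have p: "0 < ?g u u" "0 < ?g (W z) (W z)" using pos_g[OF x] u0 W0 by auto
  have "?g (coord_curvature g (snd z) u (W z) (W z)) u = k * (?g u u * ?g (W z) (W z))"
    using curv[OF x neq indep] p by (simp add: uW field_simps)
  then have "((f' (fst z))\<^sup>2 + k - f (fst z) * f'' (fst z)) * (?g (W z) (W z) * ?g u u) = 0"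
    unfolding curvature_W[OF z uW] by (simp add: algebra_simps)
  then show False using nondeg[OF t] p by simp
qed

text \<open>With \<open>W\<close> zero throughout \<open>Q\<close>, the first order equations reduce
  to d\<phi> = \<phi> (f'/f) dt, which is the vanishing of d(\<phi>/f).\<close>

lemma \<phi>_div_f_deriv:
  assumes W0: "\<And>z. z \<in> Q \<Longrightarrow> W z = 0" and z: "z \<in> Q"
  shows "((\<lambda>z. \<phi> z / f (fst z)) has_derivative (\<lambda>\<xi>. 0)) (at z)"
proof -
  have t: "fst z \<in> I" and x: "snd z \<in> U" using fst_snd_Q[OF z] by auto
  have f: "f (fst z) > 0" using f_pos t .
  have df: "((\<lambda>z. f (fst z)) has_derivative (\<lambda>\<xi>. f' (fst z) * fst \<xi>)) (at z)"
    using has_derivative_compose[OF has_derivative_fst[OF has_derivative_ident]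
        f_deriv[OF t, THEN has_field_derivative_imp_has_derivative]] by simp
  note dV = V_deriv[OF z]
  have "((\<lambda>z. W z) has_derivative (\<lambda>\<xi>. 0)) (at z)"
    by (rule has_derivative_transform_within_open[OF has_derivative_const open_Q z]) (simp add: W0)
  from has_derivative_unique[OF this has_derivative_snd[OF dV]]
  have dW: "snd (dd V z \<xi>) = 0" for \<xi> by (metis)
  have sp: "fst (dd V z (0, v)) = 0" for v
    by (simp add: \<phi>_space[OF z] W0[OF z] g_algebra x)
  \<comment> \<open>The equation reads b v = 0 for every \<open>v\<close>, so one nonzero vector is
    enough to conclude; the index is arbitrary.\<close>
  let ?v = "axis undefined 1 :: real^'n"
  have "(fst (dd V z e0) - \<phi> z * f' (fst z) / f (fst z)) *\<^sub>R ?v = 0"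
    using W_space[OF z, of ?v] linear_0[OF linear_christoffel[OF x]] by (simp add: dW W0[OF z])
  then have tm: "fst (dd V z e0) = \<phi> z * f' (fst z) / f (fst z)"
    by (simp add: axis_eq_0_iff)
  have dphi: "fst (dd V z \<xi>) = \<phi> z * f' (fst z) / f (fst z) * fst \<xi>" for \<xi>
  proof -
    note lin = has_derivative_linear[OF dV]
    have "dd V z (fst \<xi> *\<^sub>R e0 + (0, snd \<xi>)) = fst \<xi> *\<^sub>R dd V z e0 + dd V z (0, snd \<xi>)"
      by (simp only: linear_add[OF lin] linear_cmul[OF lin])
    then have "dd V z \<xi> = fst \<xi> *\<^sub>R dd V z e0 + dd V z (0, snd \<xi>)" by simp
    then show ?thesis by (simp add: sp tm)
  qed
  show ?thesis
    by (rule has_derivative_eq_rhs, rule has_derivative_divide'[OF has_derivative_fst[OF dV] df])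
      (use f in \<open>auto simp: dphi field_simps\<close>)
qed

end

section \<open>Isometries between warped products in charts\<close>

lemma dd_inverse_cancel:
  assumes "open Q" "z \<in> Q" "\<And>y. y \<in> Q \<Longrightarrow> P (F y) = y"
    "(F has_derivative dd F z) (at z)" "(P has_derivative dd P (F z)) (at (F z))"
  shows "dd P (F z) (dd F z v) = v"
proof -
  have "((\<lambda>y. y) has_derivative (\<lambda>v. dd P (F z) (dd F z v))) (at z)"
    by (rule has_derivative_transform_within_open[OF has_derivative_compose[OF assms(4,5)] assms(1,2)])
      (simp add: assms(3))
  from has_derivative_unique[OF this has_derivative_ident] show ?thesis by (rule fun_cong)
qed

lemma smooth_on_Ck: "smooth_on S f \<Longrightarrow> Ck_on k S f"
  by (simp add: smooth_on_def)

lemma smooth_on_has_derivative: "smooth_on S f \<Longrightarrow> x \<in> S \<Longrightarrow> (f has_derivative dd f x) (at x)"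
  by (rule Ck_on_has_derivative[OF smooth_on_Ck[where k = "Suc 0"]])

lemma smooth_on_dd: "smooth_on S f \<Longrightarrow> smooth_on S (\<lambda>x. dd f x v)"
  unfolding smooth_on_def by (metis Ck_on_dd)

text \<open>The coordinate expressions \<open>F\<close> and \<open>P\<close> of an isometry and its
  inverse in a pair of charts. The target slice lives in an arbitrary Euclidean space: curvature
  arguments take place on the source only.\<close>

locale warped_isometry =
  M: warped_coord U g I f f' + N: warped_coord U2 g2 J h h'
  for U :: "(real^'n) set" and g I f f' and U2 :: "'e::euclidean_space set" and g2 J h h' +
  fixes f'' :: "real \<Rightarrow> real" and Q :: "(real \<times> (real^'n)) set" and Q2 :: "(real \<times> 'e) set" and F P
  assumes f'_deriv: "t \<in> I \<Longrightarrow> (f' has_real_derivative f'' t) (at t)"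
    and smooth_h: "smooth_on J h"
    and open_Q: "open Q" and Q_subset: "Q \<subseteq> I \<times> U"
    and open_Q2: "open Q2" and Q2_subset: "Q2 \<subseteq> J \<times> U2"
    and FQ: "F ` Q \<subseteq> Q2" and PQ: "P ` Q2 \<subseteq> Q"
    and PF: "z \<in> Q \<Longrightarrow> P (F z) = z" and FP: "y \<in> Q2 \<Longrightarrow> F (P y) = y"
    and smooth_F: "smooth_on Q F" and smooth_P: "smooth_on Q2 P"
    and isom: "z \<in> Q \<Longrightarrow> M.G z u v = N.G (F z) (dd F z u) (dd F z v)"
begin

lemma F_in: "z \<in> Q \<Longrightarrow> F z \<in> Q2" and P_in: "y \<in> Q2 \<Longrightarrow> P y \<in> Q"
  using FQ PQ by auto

lemma dd_FP: "y \<in> Q2 \<Longrightarrow> dd F (P y) (dd P y v) = v"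
  by (rule dd_inverse_cancel[where P = F and F = P, OF open_Q2])
    (auto intro!: FP smooth_on_has_derivative[OF smooth_F] smooth_on_has_derivative[OF smooth_P] P_in)

lemma dd_FP': "z \<in> Q \<Longrightarrow> dd F z (dd P (F z) v) = v"
  using dd_FP[OF F_in] PF by simp

lemma linear_dd_F: "z \<in> Q \<Longrightarrow> linear (dd F z)"
  using smooth_on_has_derivative[OF smooth_F] has_derivative_linear by blast

text \<open>The pullback of the closed conformal field \<open>h \<partial>\<^sub>s\<close> of the second warped product.\<close>

definition "V z = h (fst (F z)) *\<^sub>R dd P (F z) (1, 0)"

lemma smooth_V: "smooth_on Q V"
  unfolding smooth_on_def V_def
proof
  fix k
  have F: "Ck_on k Q F" and P: "Ck_on k Q2 (\<lambda>y. dd P y (1, 0))" and h: "Ck_on k J h"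
    using smooth_on_Ck smooth_F smooth_on_dd[OF smooth_P] smooth_h by blast+
  have "Ck_on k Q (\<lambda>z. fst (F z))"
    by (rule Ck_on_bounded_linear[OF bounded_linear_fst open_Q F])
  moreover have "(\<lambda>z. fst (F z)) ` Q \<subseteq> J" using FQ Q2_subset by fastforce
  ultimately have "Ck_on k Q (\<lambda>z. h (fst (F z)))"
    by (rule Ck_on_compose[OF open_Q N.open_I _ h, rotated])
  moreover have "Ck_on k Q (\<lambda>z. dd P (F z) (1, 0))"
    by (rule Ck_on_compose[OF open_Q open_Q2 FQ P F])
  ultimately show "Ck_on k Q (\<lambda>z. h (fst (F z)) *\<^sub>R dd P (F z) (1, 0))"
    by (rule Ck_on_scaleR[OF open_Q])
qed

lemma dd_F_V: "z \<in> Q \<Longrightarrow> dd F z (V z) = (h (fst (F z)), 0)"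
  by (simp add: V_def linear_cmul[OF linear_dd_F] dd_FP')

lemma h_deriv: "z \<in> Q \<Longrightarrow> ((\<lambda>z. h (fst (F z))) has_derivative (\<lambda>\<xi>. h' (fst (F z)) * fst (dd F z \<xi>))) (at z)"
proof -
  assume z: "z \<in> Q"
  have "fst (F z) \<in> J" using F_in[OF z] Q2_subset by auto
  from has_derivative_compose[OF has_derivative_fst[OF smooth_on_has_derivative[OF smooth_F z]]
      N.f_deriv[OF this, THEN has_field_derivative_imp_has_derivative]]
  show ?thesis by simp
qed

text \<open>The differential of \<open>F\<close> carries \<open>V\<close> to h times the time field,
  so the one-form of \<open>V\<close> is the pullback of - h ds. Its exterior derivative vanishes
  because the second derivatives of \<open>F\<close> are symmetric and the remaining term is
  symmetric as well.\<close>

lemma closed_V: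
  assumes z: "z \<in> Q"
  shows "dd (\<lambda>z. M.G z (V z) v) z u = dd (\<lambda>z. M.G z (V z) u) z v"
proof -
  have 1: "M.G y (V y) v = - (h (fst (F y)) * fst (dd F y v))" if "y \<in> Q" for y v
  proof -
    have "snd (F y) \<in> U2" using F_in[OF that] Q2_subset by auto
    then show ?thesis
      unfolding isom[OF that] dd_F_V[OF that] by (simp add: warped_metric_def N.g_algebra)
  qed
  have 2: "dd (\<lambda>z. M.G z (V z) v) z u = - (h (fst (F z)) * fst (dd (\<lambda>z. dd F z v) z u)
      + h' (fst (F z)) * fst (dd F z u) * fst (dd F z v))" for u v
  proof -
    have "((\<lambda>y. - (h (fst (F y)) * fst (dd F y v))) has_derivative
      (\<lambda>u. - (h (fst (F z)) * fst (dd (\<lambda>z. dd F z v) z u)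
      + h' (fst (F z)) * fst (dd F z u) * fst (dd F z v)))) (at z)"
      by (intro has_derivative_minus has_derivative_mult has_derivative_fst h_deriv[OF z]
          smooth_on_has_derivative[OF smooth_on_dd[OF smooth_F] z])
    then have "((\<lambda>z. M.G z (V z) v) has_derivative
      (\<lambda>u. - (h (fst (F z)) * fst (dd (\<lambda>z. dd F z v) z u)
      + h' (fst (F z)) * fst (dd F z u) * fst (dd F z v)))) (at z)"
      by (rule has_derivative_transform_within_open[OF _ open_Q z]) (simp add: 1)
    then show ?thesis by (rule dd_eqI[THEN fun_cong])
  qed
  show ?thesis
    unfolding 2 using dd_commute[OF open_Q z smooth_on_Ck[OF smooth_F], of u v] by simp
qed

text \<open>The Lie derivative commutes with isometries, and h times the time field rescales the
  target metric at rate 2 h'. The calculation differentiates the isometry equation along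
  \<open>V\<close>; the second derivatives \<open>?D2\<close> of \<open>F\<close> cancel against
  those hidden in the derivative of \<open>V\<close>.\<close>

lemma conformal_V:
  assumes z: "z \<in> Q"
  shows "dd (\<lambda>z. M.G z u v) z (V z) + M.G z (dd V z u) v + M.G z u (dd V z v)
    = 2 * h' (fst (F z)) * M.G z u v"
proof -
  have Fz: "F z \<in> J \<times> U2" using F_in[OF z] Q2_subset by auto
  then have x2: "snd (F z) \<in> U2" by auto
  let ?s = "fst (F z)"
  let ?D2 = "\<lambda>u. dd (\<lambda>y. dd F y u) z (V z)"
  note dF = smooth_on_has_derivative[OF smooth_F z]
  note ddF = smooth_on_has_derivative[OF smooth_on_dd[OF smooth_F] z]
  have "((\<lambda>y. N.G (F y) (dd F y u) (dd F y v)) has_derivative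
    (\<lambda>\<xi>. dd (\<lambda>y. N.G y (dd F z u) (dd F z v)) (F z) (dd F z \<xi>)
      + N.G (F z) (dd (\<lambda>y. dd F y u) z \<xi>) (dd F z v) + N.G (F z) (dd F z u) (dd (\<lambda>y. dd F y v) z \<xi>))) (at z)"
    by (rule N.has_derivative_G_moving[OF open_Q z _ dF ddF ddF]) (use FQ Q2_subset in blast)
  then have "((\<lambda>y. M.G y u v) has_derivative
    (\<lambda>\<xi>. dd (\<lambda>y. N.G y (dd F z u) (dd F z v)) (F z) (dd F z \<xi>)
      + N.G (F z) (dd (\<lambda>y. dd F y u) z \<xi>) (dd F z v) + N.G (F z) (dd F z u) (dd (\<lambda>y. dd F y v) z \<xi>))) (at z)"
    by (rule has_derivative_transform_within_open[OF _ open_Q z]) (simp add: isom)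
  from dd_eqI[OF this, THEN fun_cong, of "V z"]
  have 1: "dd (\<lambda>y. M.G y u v) z (V z) = 2 * h ?s * h' ?s * h ?s * g2 (snd (F z)) (snd (dd F z u)) (snd (dd F z v))
      + N.G (F z) (?D2 u) (dd F z v) + N.G (F z) (dd F z u) (?D2 v)"
    by (simp add: dd_F_V[OF z] N.dd_G[OF Fz] linear_0[OF N.linear_dd_g[OF x2]])
  \<comment> \<open>Obtained by differentiating \<open>dd_F_V\<close> along \<open>u\<close>;
    exchanging derivatives then puts the second derivative of \<open>F\<close> in the form that
    occurs in \<open>1\<close>.\<close>
  have 2: "dd F z (dd V z u) = (h' ?s * fst (dd F z u), 0) - ?D2 u" for u
  proof -
    have "((\<lambda>y. dd F y (V y)) has_derivative
        (\<lambda>\<xi>. dd (\<lambda>y. dd F y (V z)) z \<xi> + dd F z (dd V z \<xi>))) (at z)"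
      by (rule has_derivative_linear_family[OF open_Q z linear_dd_F
            differentiableI[OF ddF] smooth_on_has_derivative[OF smooth_V z]])
    then have "((\<lambda>y. (h (fst (F y)), 0)) has_derivative
        (\<lambda>\<xi>. dd (\<lambda>y. dd F y (V z)) z \<xi> + dd F z (dd V z \<xi>))) (at z)"
      by (rule has_derivative_transform_within_open[OF _ open_Q z]) (simp add: dd_F_V)
    from has_derivative_unique[OF has_derivative_Pair[OF h_deriv[OF z] has_derivative_const] this]
    have "(h' ?s * fst (dd F z u), 0) = dd (\<lambda>y. dd F y (V z)) z u + dd F z (dd V z u)"
      by (rule fun_cong)
    moreover have "dd (\<lambda>y. dd F y (V z)) z u = ?D2 u"
      by (rule dd_commute[OF open_Q z smooth_on_Ck[OF smooth_F]])
    ultimately show ?thesis by (simp add: eq_diff_eq add.commute)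
  qed
  note bil = N.bilinear_G[OF Fz]
  have 3: "M.G z (dd V z u) v = - (h' ?s * fst (dd F z u) * fst (dd F z v)) - N.G (F z) (?D2 u) (dd F z v)" for u v
    unfolding isom[OF z] 2 bilinear_lsub[OF bil]
    by (simp add: warped_metric_def N.g_algebra[OF x2])
  have z': "z \<in> I \<times> U" using z Q_subset by auto
  have 4: "M.G z u (dd V z v) = - (h' ?s * fst (dd F z v) * fst (dd F z u)) - N.G (F z) (dd F z u) (?D2 v)"
    using 3[of v u] M.sym_G[OF z', of u "dd V z v"] N.sym_G[OF Fz, of "dd F z u" "?D2 v"] by simp
  have "2 * h' ?s * M.G z u v = 2 * h' ?s * (- (fst (dd F z u) * fst (dd F z v))
      + (h ?s)\<^sup>2 * g2 (snd (F z)) (snd (dd F z u)) (snd (dd F z v)))"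
    unfolding isom[OF z] by (simp add: warped_metric_def)
  then show ?thesis unfolding 1 3 4 by (simp add: power2_eq_square algebra_simps)
qed

section \<open>The differential of an isometry preserves time and space directions\<close>

context
  fixes k
  assumes n: "2 \<le> CARD('n)"
    and curv: "\<And>x u v. x \<in> U \<Longrightarrow> u \<noteq> v \<Longrightarrow> independent {u, v} \<Longrightarrow>
      g x (coord_curvature g x u v v) u / (g x u u * g x v v - (g x u v)\<^sup>2) = k"
    and nondeg: "\<And>t. t \<in> I \<Longrightarrow> (f' t)\<^sup>2 + k - f t * f'' t \<noteq> 0"
begin

lemma snd_V: "z \<in> Q \<Longrightarrow> snd (V z) = 0"
proof -
  interpret W: warped_closed_conformal U g I f f' f'' Q V
    by unfold_locales
      (use f'_deriv open_Q Q_subset smooth_on_Ck[OF smooth_V] closed_V conformal_V in \<open>blast+\<close>)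
  show "z \<in> Q \<Longrightarrow> snd (V z) = 0" by (rule W.W_eq_0[OF n curv nondeg])
qed

lemma snd_dd_P_time: "y \<in> Q2 \<Longrightarrow> snd (dd P y (1, 0)) = 0"
proof -
  assume y: "y \<in> Q2"
  have "0 < h (fst y)" using y Q2_subset N.f_pos by auto
  then show ?thesis using snd_V[OF P_in[OF y]] FP[OF y] by (simp add: V_def)
qed

text \<open>The inverse differential sends the time field of the target to \<alpha> times that of
  the source. Applying the differential of \<open>F\<close> again shows that \<alpha> is invertible,
  so the relation can be reversed.\<close>

lemma snd_dd_F_time: "z \<in> Q \<Longrightarrow> snd (dd F z (1, 0)) = 0"
proof -
  assume z: "z \<in> Q"
  define \<alpha> where "\<alpha> = fst (dd P (F z) (1, 0))"
  have "dd P (F z) (1, 0) = \<alpha> *\<^sub>R (1, 0)"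
    using snd_dd_P_time[OF F_in[OF z]] by (simp add: prod_eq_iff \<alpha>_def)
  then have "\<alpha> *\<^sub>R dd F z (1, 0) = (1, 0)"
    using dd_FP'[OF z, of "(1, 0)"] linear_cmul[OF linear_dd_F[OF z]] by metis
  then have "\<alpha> * fst (dd F z (1, 0)) = 1" "\<alpha> *\<^sub>R snd (dd F z (1, 0)) = 0"
    by (metis fst_conv fst_scaleR real_scaleR_def, metis snd_conv snd_scaleR)
  then show ?thesis by auto
qed

text \<open>Isometries preserve orthogonality: the target time direction is the image of a source
  time direction, so images of spatial vectors are orthogonal to it.\<close>

lemma fst_dd_F_space: "z \<in> Q \<Longrightarrow> fst (dd F z (0, v)) = 0"
proof -
  assume z: "z \<in> Q"
  have x: "snd z \<in> U" and x2: "snd (F z) \<in> U2" using F_in[OF z] z Q_subset Q2_subset by auto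
  have "M.G z (dd P (F z) (1, 0)) (0, v) = - fst (dd F z (0, v))"
    unfolding isom[OF z] dd_FP'[OF z] by (simp add: warped_metric_def N.g_algebra[OF x2])
  moreover have "M.G z (dd P (F z) (1, 0)) (0, v) = 0"
    using snd_dd_P_time[OF F_in[OF z]] by (simp add: warped_metric_def M.g_algebra[OF x])
  ultimately show ?thesis by simp
qed

lemma fst_dd_P_space: "y \<in> Q2 \<Longrightarrow> fst (dd P y (0, w)) = 0"
proof -
  assume y: "y \<in> Q2"
  have z: "P y \<in> Q" and x: "snd (P y) \<in> U" and x2: "snd y \<in> U2"
    using P_in[OF y] y Q_subset Q2_subset by auto
  have "M.G (P y) (1, 0) (dd P y (0, w)) = 0"
    unfolding isom[OF z] FP[OF y] dd_FP[OF y]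
    using snd_dd_F_time[OF z] by (simp add: warped_metric_def N.g_algebra[OF x2])
  moreover have "M.G (P y) (1, 0) (dd P y (0, w)) = - fst (dd P y (0, w))"
    by (simp add: warped_metric_def M.g_algebra[OF x])
  ultimately show ?thesis by simp
qed

end

end

section \<open>From differentials to constancy along lines and slices\<close>

lemma snd_constant_along_time:
  fixes F :: "real \<times> 'a::real_normed_vector \<Rightarrow> 'b::real_normed_vector \<times> 'c::real_normed_vector"
  assumes "convex T" "\<And>t. t \<in> T \<Longrightarrow> (F has_derivative dd F (t, x)) (at (t, x))"
    "\<And>t. t \<in> T \<Longrightarrow> snd (dd F (t, x) (1, 0)) = 0" "s \<in> T" "t \<in> T"
  shows "snd (F (s, x)) = snd (F (t, x))"
proof -
  have "((\<lambda>r. snd (F (r, x))) has_derivative (\<lambda>h. 0)) (at r within T)" if "r \<in> T" for r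
  proof -
    have "((\<lambda>r. (r, x)) has_derivative (\<lambda>h. (h, 0))) (at r)"
      by (auto intro!: derivative_eq_intros)
    from has_derivative_snd[OF has_derivative_compose[OF this assms(2)[OF that]]]
    have "((\<lambda>r. snd (F (r, x))) has_derivative (\<lambda>h. snd (dd F (r, x) (h, 0)))) (at r)" .
    moreover have "snd (dd F (r, x) (h, 0)) = 0" for h
      using linear_cmul[OF has_derivative_linear[OF assms(2)[OF that]], of h "(1, 0)"] assms(3)[OF that]
      by simp
    ultimately show ?thesis by (simp add: has_derivative_at_withinI)
  qed
  from has_derivative_zero_constant[OF assms(1) this] show ?thesis using assms(4,5) by auto
qed

lemma fst_constant_along_space:
  fixes F :: "real \<times> 'a::real_normed_vector \<Rightarrow> 'b::real_normed_vector \<times> 'c::real_normed_vector"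
  assumes "convex B" "\<And>x. x \<in> B \<Longrightarrow> (F has_derivative dd F (t, x)) (at (t, x))"
    "\<And>x v. x \<in> B \<Longrightarrow> fst (dd F (t, x) (0, v)) = 0" "x \<in> B" "y \<in> B"
  shows "fst (F (t, x)) = fst (F (t, y))"
proof -
  have "((\<lambda>r. fst (F (t, r))) has_derivative (\<lambda>h. 0)) (at r within B)" if "r \<in> B" for r
  proof -
    have "((\<lambda>r. (t, r)) has_derivative (\<lambda>h. (0, h))) (at r)"
      by (auto intro!: derivative_eq_intros)
    from has_derivative_fst[OF has_derivative_compose[OF this assms(2)[OF that]]]
    show ?thesis by (simp add: has_derivative_at_withinI assms(3)[OF that])
  qed
  from has_derivative_zero_constant[OF assms(1) this] show ?thesis using assms(4,5) by auto
qed

section \<open>The Friedmann equation\<close>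

lemma smooth_on_has_real_derivative:
  fixes f :: "real \<Rightarrow> real"
  assumes "smooth_on I f" "t \<in> I"
  shows "(f has_real_derivative deriv f t) (at t)"
  using smooth_on_has_derivative[OF assms] has_derivative_imp_has_field_derivative
  by (metis DERIV_deriv_iff_real_differentiable differentiableI)

lemma smooth_on_deriv:
  fixes f :: "real \<Rightarrow> real"
  assumes "open I" "smooth_on I f"
  shows "smooth_on I (deriv f)"
proof -
  have "deriv f t = dd f t 1" if "t \<in> I" for t
  proof -
    have "(f has_derivative (*) (deriv f t)) (at t)"
      using smooth_on_has_real_derivative[OF assms(2) that] by (simp add: has_field_derivative_def)
    then show ?thesis by (simp add: dd_eqI)
  qed
  then have "Ck_on k I (deriv f)" for k
    by (intro Ck_on_cong[OF assms(1) smooth_on_Ck[OF smooth_on_dd[OF assms(2), of 1]]]) simp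
  then show ?thesis by (simp add: smooth_on_def)
qed

text \<open>The derivative of the Friedmann equation is f' q = 0, and q = 0 is wanted even at zeros
  of f'. Near a point with q nonzero, f' vanishes identically, which pins the value of q down. Thus
  q is continuous with at most two values on an interval, hence constant; a nonzero constant would
  make f' vanish everywhere, contradicting that \<open>f\<close> is not constant.\<close>

lemma Friedmann_nondegenerate:
  fixes f :: "real \<Rightarrow> real"
  assumes I: "open I" "is_interval I" and sm: "smooth_on I f" and pos: "\<And>t. t \<in> I \<Longrightarrow> 0 < f t"
    and nc: "\<not> f constant_on I" and A: "A > 0"
    and eq: "\<And>t. t \<in> I \<Longrightarrow> (deriv f t)\<^sup>2 + k = A / f t"
    and t: "t \<in> I"
  shows "(deriv f t)\<^sup>2 + k - f t * deriv (deriv f) t \<noteq> 0"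
proof -
  note sm' = smooth_on_deriv[OF I(1) sm]
  note df = smooth_on_has_real_derivative[OF sm] and ddf = smooth_on_has_real_derivative[OF sm']
  define q where "q t = 2 * deriv (deriv f) t + A / (f t)\<^sup>2" for t
  have f'q: "deriv f t * q t = 0" if t: "t \<in> I" for t
  proof -
    have "((\<lambda>t. (deriv f t)\<^sup>2 + k) has_real_derivative 2 * deriv f t * deriv (deriv f) t) (at t)"
      by (auto intro!: derivative_eq_intros ddf t)
    then have "((\<lambda>t. A / f t) has_real_derivative 2 * deriv f t * deriv (deriv f) t) (at t)"
      by (rule has_field_derivative_transform_within_open[OF _ I(1) t]) (rule eq)
    moreover have "((\<lambda>t. A / f t) has_real_derivative - A * deriv f t / (f t)\<^sup>2) (at t)"
      using pos[OF t] by (auto intro!: derivative_eq_intros df t simp: power2_eq_square)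
    ultimately have "2 * deriv f t * deriv (deriv f) t = - A * deriv f t / (f t)\<^sup>2"
      by (rule DERIV_unique)
    then show ?thesis by (simp add: q_def algebra_simps)
  qed
  have contf: "continuous_on I f" and contf2: "continuous_on I (deriv (deriv f))"
    using smooth_on_Ck[OF sm, of 0] smooth_on_Ck[OF smooth_on_deriv[OF I(1) sm'], of 0] by auto
  have contq: "continuous_on I q"
    unfolding q_def using pos by (intro continuous_intros contf contf2) fastforce
  have q_values: "q t = 0 \<or> q t = k\<^sup>2 / A" if t: "t \<in> I" for t
  proof (cases "q t = 0")
    case False
    have "open {s \<in> I. q s \<noteq> 0}"
      using continuous_open_preimage[OF contq I(1), of "- {0}"] by (simp add: vimage_def Int_def open_Compl)
    moreover have "deriv f s = 0" if "s \<in> {s \<in> I. q s \<noteq> 0}" for s using f'q that by auto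
    ultimately have "((deriv f) has_real_derivative 0) (at t)"
      using False t 
      by (intro has_field_derivative_transform_within_open[OF DERIV_const, of "{s \<in> I. q s \<noteq> 0}" t 0]) auto
    then have "deriv (deriv f) t = 0" using DERIV_imp_deriv by blast
    \<comment> \<open>With f'' = 0 only A/f^2 remains in \<open>q\<close>, and A/f = k turns it into
      k^2/A, a value that does not depend on \<open>t\<close>.\<close>
    moreover have "k = A / f t" using eq[OF t] f'q[OF t] False by simp
    ultimately show ?thesis using A pos[OF t] by (simp add: q_def power2_eq_square)
  qed simp
  have "q constant_on I"
  proof (rule continuous_finite_range_constant[OF _ contq])
    show "connected I" using I(2) by (simp add: is_interval_connected)
    have "q ` I \<subseteq> {0, k\<^sup>2 / A}" using q_values by auto
    then show "finite (q ` I)" using finite_subset by blast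
  qed
  then obtain c where c: "\<And>t. t \<in> I \<Longrightarrow> q t = c" by (auto simp: constant_on_def)
  have "c = 0"
  proof (rule ccontr)
    assume "c \<noteq> 0"
    then have d0: "deriv f t = 0" if "t \<in> I" for t using f'q[OF that] c[OF that] by simp
    have "\<exists>c. \<forall>t\<in>I. f t = c"
    proof (rule has_derivative_zero_constant)
      show "convex I" using I(2) by (simp add: is_interval_convex)
      show "(f has_derivative (\<lambda>h. 0)) (at t within I)" if "t \<in> I" for t
        by (rule has_derivative_eq_rhs[OF has_derivative_at_withinI
              [OF df[OF that, THEN has_field_derivative_imp_has_derivative]]])
          (simp add: d0[OF that] fun_eq_iff)
    qed
    then show False using nc by (auto simp: constant_on_def)
  qed
  then have f'': "2 * deriv (deriv f) t = - A / (f t)\<^sup>2" using c[OF t] by (simp add: q_def)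
  have "2 * (f t * deriv (deriv f) t) = f t * (2 * deriv (deriv f) t)" by simp
  also have "\<dots> = f t * (- A / (f t)\<^sup>2)" by (simp only: f'')
  also have "\<dots> = - A / f t" by (simp add: power2_eq_square)
  finally have "2 * (f t * deriv (deriv f) t) = - A / f t" .
  then have "2 * ((deriv f t)\<^sup>2 + k - f t * deriv (deriv f) t) = 3 * (A / f t)"
    using eq[OF t] by simp
  moreover have "A / f t > 0" using A pos[OF t] by simp
  ultimately show ?thesis by auto
qed

section \<open>Correspondence of leaves\<close>

text \<open>The values of \<open>c\<close> carry no topology, so a separation is built directly:
  neighbourhoods of the points with value \<open>c p\<close> against neighbourhoods of the others.
  They cannot meet inside \<open>S\<close>.\<close>

lemma connectedin_locally_constant:
  assumes S: "connectedin X S"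
    and loc: "\<And>p. p \<in> S \<Longrightarrow> \<exists>T. openin X T \<and> p \<in> T \<and> (\<forall>q\<in>T \<inter> S. c q = c p)"
    and "p \<in> S" "q \<in> S"
  shows "c q = c p"
proof (rule ccontr)
  assume neq: "c q \<noteq> c p"
  obtain T where T: "\<And>p. p \<in> S \<Longrightarrow> openin X (T p) \<and> p \<in> T p \<and> (\<forall>q\<in>T p \<inter> S. c q = c p)"
    using loc by metis
  let ?E = "\<Union>r\<in>{r \<in> S. c r = c p}. T r" and ?F = "\<Union>r\<in>{r \<in> S. c r \<noteq> c p}. T r"
  have "openin X ?E" "openin X ?F" using T by auto
  moreover have "S \<subseteq> ?E \<union> ?F" using T by auto
  moreover have "?E \<inter> ?F \<inter> S = {}"
  proof (rule ccontr)
    assume "?E \<inter> ?F \<inter> S \<noteq> {}"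
    then obtain x r s where "x \<in> S" "r \<in> S" "s \<in> S" "x \<in> T r" "x \<in> T s" "c r = c p" "c s \<noteq> c p"
      by blast
    then show False using T[of r] T[of s] by (metis IntI)
  qed
  moreover have "?E \<inter> S \<noteq> {}" using T[OF assms(3)] assms(3) by blast
  moreover have "?F \<inter> S \<noteq> {}" using T[OF assms(4)] assms(4) neq by blast
  ultimately show False using S unfolding connectedin by blast
qed

text \<open>Leaves are taken as fibres of maps \<alpha> and \<beta>, so that one argument serves
  both foliations, with \<open>snd\<close> and with \<open>fst\<close>. Connectedness of a component
  in the source confines its image to one fibre; connectedness of that fibre confines its preimage
  to one component.\<close>

lemma leaves_correspond:
  assumes \<phi>: "continuous_map (subtopology X \<Omega>) Y \<phi>" and \<psi>: "continuous_map Y (subtopology X \<Omega>) \<psi>"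
    and \<Omega>: "\<Omega> \<subseteq> topspace X"
    and \<psi>\<phi>: "\<And>p. p \<in> \<Omega> \<Longrightarrow> \<psi> (\<phi> p) = p" and \<phi>\<psi>: "\<And>q. q \<in> topspace Y \<Longrightarrow> \<phi> (\<psi> q) = q"
    and loc\<phi>: "\<And>p. p \<in> \<Omega> \<Longrightarrow> \<exists>T. openin X T \<and> p \<in> T \<and> (\<forall>q\<in>T \<inter> \<Omega>. \<alpha> q = \<alpha> p \<longrightarrow> \<beta> (\<phi> q) = \<beta> (\<phi> p))"
    and loc\<psi>: "\<And>q. q \<in> topspace Y \<Longrightarrow> \<exists>T. openin Y T \<and> q \<in> T \<and> (\<forall>r\<in>T. \<beta> r = \<beta> q \<longrightarrow> \<alpha> (\<psi> r) = \<alpha> (\<psi> q))"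
    and conn: "\<And>q. q \<in> topspace Y \<Longrightarrow> connectedin Y {r \<in> topspace Y. \<beta> r = \<beta> q}"
  shows "(`) \<phi> ` restrict_foliation X {{p \<in> topspace X. \<alpha> p = a} | a. a \<in> \<alpha> ` topspace X} \<Omega>
    = {{q \<in> topspace Y. \<beta> q = b} | b. b \<in> \<beta> ` topspace Y}"
proof -
  let ?S = "\<lambda>a. {p \<in> topspace X. \<alpha> p = a} \<inter> \<Omega>"
  let ?L = "\<lambda>b. {q \<in> topspace Y. \<beta> q = b}"
  have topY: "\<phi> p \<in> topspace Y" if "p \<in> \<Omega>" for p
    using continuous_map_image_subset_topspace[OF \<phi>] that \<Omega> by auto
  have in\<Omega>: "\<psi> q \<in> \<Omega>" if "q \<in> topspace Y" for q
    using continuous_map_image_subset_topspace[OF \<psi>] that by auto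
  have comp: "\<phi> ` connected_component_of_set (subtopology X (?S (\<alpha> p))) p = ?L (\<beta> (\<phi> p))"
    if p: "p \<in> \<Omega>" for p
  proof -
    define K where "K = connected_component_of_set (subtopology X (?S (\<alpha> p))) p"
    have pK: "p \<in> K" using p \<Omega> by (auto simp: K_def connected_component_of_refl)
    have K: "connectedin X K" "K \<subseteq> ?S (\<alpha> p)"
      using connectedin_connected_component_of[of "subtopology X (?S (\<alpha> p))" p]
      unfolding K_def[symmetric] connectedin_subtopology by auto
    have "\<beta> (\<phi> q) = \<beta> (\<phi> p)" if "q \<in> K" for q
    proof (rule connectedin_locally_constant[OF K(1) _ pK that, of "\<lambda>q. \<beta> (\<phi> q)"])
      fix r assume "r \<in> K"
      then have r: "r \<in> \<Omega>" "\<alpha> r = \<alpha> p" using K(2) by auto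
      then obtain T where T: "openin X T" "r \<in> T" "\<forall>q\<in>T \<inter> \<Omega>. \<alpha> q = \<alpha> r \<longrightarrow> \<beta> (\<phi> q) = \<beta> (\<phi> r)"
        using loc\<phi> by blast
      moreover have "\<alpha> q = \<alpha> r" "q \<in> \<Omega>" if "q \<in> K" for q using K(2) r(2) that by auto
      ultimately show "\<exists>T. openin X T \<and> r \<in> T \<and> (\<forall>q\<in>T \<inter> K. \<beta> (\<phi> q) = \<beta> (\<phi> r))"
        by (intro exI[of _ T]) simp
    qed
    then have 1: "\<phi> ` K \<subseteq> ?L (\<beta> (\<phi> p))" using K(2) topY by auto
    let ?M = "?L (\<beta> (\<phi> p))"
    have M: "connectedin Y ?M" by (rule conn[OF topY[OF p]])
    have pM: "\<phi> p \<in> ?M" using topY[OF p] by simp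
    have "\<alpha> (\<psi> r) = \<alpha> (\<psi> (\<phi> p))" if "r \<in> ?M" for r
    proof (rule connectedin_locally_constant[OF M _ pM that, of "\<lambda>r. \<alpha> (\<psi> r)"])
      fix s assume s: "s \<in> ?M"
      then obtain T where T: "openin Y T" "s \<in> T" "\<forall>r\<in>T. \<beta> r = \<beta> s \<longrightarrow> \<alpha> (\<psi> r) = \<alpha> (\<psi> s)"
        using loc\<psi> by blast
      have "\<alpha> (\<psi> r) = \<alpha> (\<psi> s)" if "r \<in> T \<inter> ?M" for r
      proof -
        have "\<beta> r = \<beta> (\<phi> p)" "\<beta> s = \<beta> (\<phi> p)" using s that by blast+
        then show ?thesis using T(3) that by (metis IntD1)
      qed
      then show "\<exists>T. openin Y T \<and> s \<in> T \<and> (\<forall>r\<in>T \<inter> ?M. \<alpha> (\<psi> r) = \<alpha> (\<psi> s))"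
        using T(1,2) by blast
    qed
    \<comment> \<open>The preimage of the full fibre is connected, lies in the restricted leaf
      through \<open>p\<close> and contains \<open>p\<close>; maximality of the component then gives
      the reverse inclusion.\<close>
    then have "\<psi> ` ?M \<subseteq> ?S (\<alpha> p)" using in\<Omega> \<Omega> \<psi>\<phi>[OF p] by fastforce
    moreover have "connectedin X (\<psi> ` ?M)"
      using connectedin_continuous_map_image[OF \<psi> M] by (simp add: connectedin_subtopology)
    ultimately have "connectedin (subtopology X (?S (\<alpha> p))) (\<psi> ` ?M)"
      by (simp add: connectedin_subtopology)
    moreover have "p \<in> \<psi> ` ?M" using pM \<psi>\<phi>[OF p] by force
    ultimately have "\<psi> ` ?M \<subseteq> K" unfolding K_def by (rule connected_component_of_maximal)
    then have "\<phi> ` \<psi> ` ?M \<subseteq> \<phi> ` K" by blast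
    moreover have "\<phi> ` \<psi> ` ?M = ?M" using \<phi>\<psi> by (force simp: image_image)
    ultimately show ?thesis using 1 unfolding K_def by blast
  qed
  \<comment> \<open>The restricted foliation is parametrised by the points of \<Omega>: each piece
    is the component through any of its points.\<close>
  have rf: "restrict_foliation X {{p \<in> topspace X. \<alpha> p = a} | a. a \<in> \<alpha> ` topspace X} \<Omega>
      = (\<lambda>p. connected_component_of_set (subtopology X (?S (\<alpha> p))) p) ` \<Omega>"
  proof (intro equalityI subsetI)
    fix C assume "C \<in> restrict_foliation X {{p \<in> topspace X. \<alpha> p = a} | a. a \<in> \<alpha> ` topspace X} \<Omega>"
    then obtain a p where "p \<in> ?S a" "C = connected_component_of_set (subtopology X (?S a)) p"
      by (auto simp: restrict_foliation_def connected_components_of_def)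
    then show "C \<in> (\<lambda>p. connected_component_of_set (subtopology X (?S (\<alpha> p))) p) ` \<Omega>" by blast
  next
    fix C assume "C \<in> (\<lambda>p. connected_component_of_set (subtopology X (?S (\<alpha> p))) p) ` \<Omega>"
    then obtain p where p: "p \<in> \<Omega>" "C = connected_component_of_set (subtopology X (?S (\<alpha> p))) p"
      by blast
    then have "p \<in> topspace (subtopology X (?S (\<alpha> p)))" using \<Omega> by auto
    then have "C \<in> connected_components_of (subtopology X (?S (\<alpha> p)))"
      using p(2) by (simp add: connected_component_in_connected_components_of)
    then show "C \<in> restrict_foliation X {{p \<in> topspace X. \<alpha> p = a} | a. a \<in> \<alpha> ` topspace X} \<Omega>"
      using p(1) \<Omega> unfolding restrict_foliation_def by blast
  qed
  have "(`) \<phi> ` restrict_foliation X {{p \<in> topspace X. \<alpha> p = a} | a. a \<in> \<alpha> ` topspace X} \<Omega>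
      = (\<lambda>p. ?L (\<beta> (\<phi> p))) ` \<Omega>"
    unfolding rf image_image by (rule image_cong[OF refl comp])
  also have "\<dots> = {?L b | b. b \<in> \<beta> ` topspace Y}"
  proof (intro equalityI subsetI)
    fix A assume "A \<in> (\<lambda>p. ?L (\<beta> (\<phi> p))) ` \<Omega>"
    then show "A \<in> {?L b | b. b \<in> \<beta> ` topspace Y}" using topY by blast
  next
    fix A assume "A \<in> {?L b | b. b \<in> \<beta> ` topspace Y}"
    then obtain q where q: "q \<in> topspace Y" "A = ?L (\<beta> q)" by blast
    then have "A = ?L (\<beta> (\<phi> (\<psi> q)))" by (simp add: \<phi>\<psi>)
    then show "A \<in> (\<lambda>p. ?L (\<beta> (\<phi> p))) ` \<Omega>" using in\<Omega>[OF q(1)] by blast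
  qed
  finally show ?thesis .
qed

section \<open>Charts of a warped product\<close>

lemma warped_product_simps [simp]:
  "mtop (warped_product I f L) = prod_topology (top_of_set I) (mtop L)"
  "idx (warped_product I f L) = idx L"
  "cdom (warped_product I f L) i = I \<times> cdom L i"
  "cmap (warped_product I f L) i p = (fst p, cmap L i (snd p))"
  "gmet (warped_product I f L) i p u v = - (fst u * fst v) + (f (fst p))\<^sup>2 * gmet L i (snd p) (snd u) (snd v)"
  by (simp_all add: warped_product_def split_beta)

lemma open_submanifold_simps [simp]:
  "mtop (open_submanifold M \<Omega>) = subtopology (mtop M) \<Omega>"
  "idx (open_submanifold M \<Omega>) = idx M"
  "cdom (open_submanifold M \<Omega>) i = cdom M i \<inter> \<Omega>"
  "cmap (open_submanifold M \<Omega>) = cmap M"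
  "gmet (open_submanifold M \<Omega>) = gmet M"
  by (simp_all add: open_submanifold_def)

abbreviation coord_metric_of :: "('m, 'e, 'i) metric_manifold \<Rightarrow> 'i \<Rightarrow> 'e \<Rightarrow> 'e \<Rightarrow> 'e \<Rightarrow> real" where
  "coord_metric_of L i \<equiv> \<lambda>x. gmet L i (cinv L i x)"

locale grw =
  fixes I :: "real set" and f :: "real \<Rightarrow> real" and L :: "('l, 'e::euclidean_space, 'i) metric_manifold"
  assumes GRW: "is_GRW I f L"
begin

abbreviation "M \<equiv> warped_product I f L"

abbreviation "wchart i p \<equiv> (fst p, cmap L i (snd p))"
abbreviation "wchart_inv i z \<equiv> (fst z, cinv L i (snd z))"

lemma open_I: "open I" and interval_I: "is_interval I" and I_nonempty: "I \<noteq> {}"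
  and smooth_f: "smooth_on I f" and f_pos: "t \<in> I \<Longrightarrow> 0 < f t"
  and riem: "riemannian_manifold L" and connected_L: "connected_space (mtop L)"
  using GRW by (auto simp: is_GRW_def)

lemma manifold: "smooth_manifold L"
  using riem by (simp add: riemannian_manifold_def)

lemma topspace_L: "topspace (mtop L) = (\<Union>i\<in>idx L. cdom L i)"
  using manifold by (simp add: smooth_manifold_def)

context
  fixes i assumes i: "i \<in> idx L"
begin

lemma openin_cdom: "openin (mtop L) (cdom L i)"
  and open_cimg: "open (cimg L i)"
  and homeo: "homeomorphic_map (subtopology (mtop L) (cdom L i)) (top_of_set (cimg L i)) (cmap L i)"
  using manifold i by (simp_all add: smooth_manifold_def)

lemma topspace_cdom: "topspace (subtopology (mtop L) (cdom L i)) = cdom L i"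
  using openin_subset[OF openin_cdom] by auto

lemma inj_cmap: "inj_on (cmap L i) (cdom L i)"
  using homeomorphic_imp_injective_map[OF homeo] topspace_cdom by simp

lemma cinv_cmap: "p \<in> cdom L i \<Longrightarrow> cinv L i (cmap L i p) = p"
  unfolding cinv_def using inj_cmap by (rule inv_into_f_f)

lemma cmap_cinv: "x \<in> cimg L i \<Longrightarrow> cmap L i (cinv L i x) = x"
  unfolding cinv_def by (rule f_inv_into_f)

lemma cinv_in: "x \<in> cimg L i \<Longrightarrow> cinv L i x \<in> cdom L i"
  unfolding cinv_def by (rule inv_into_into)

lemma continuous_cmap: "continuous_map (subtopology (mtop L) (cdom L i)) (top_of_set (cimg L i)) (cmap L i)"
  using homeo by (rule homeomorphic_imp_continuous_map)

lemma continuous_cinv: "continuous_map (top_of_set (cimg L i)) (mtop L) (cinv L i)"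
proof -
  obtain g where g: "homeomorphic_maps (subtopology (mtop L) (cdom L i)) (top_of_set (cimg L i)) (cmap L i) g"
    using homeo homeomorphic_map_maps by blast
  then have "continuous_map (top_of_set (cimg L i)) (mtop L) g"
    by (simp add: homeomorphic_maps_def continuous_map_in_subtopology)
  moreover have "g x = cinv L i x" if x: "x \<in> topspace (top_of_set (cimg L i))" for x
  proof -
    obtain p where p: "p \<in> cdom L i" "x = cmap L i p" using x by auto
    then have "g x = p" using g topspace_cdom by (simp add: homeomorphic_maps_def)
    then show ?thesis using p cinv_cmap by simp
  qed
  ultimately show ?thesis by (rule continuous_map_eq)
qed

lemma coord_metric: "coord_metric (cimg L i) (coord_metric_of L i)"
proof
  have *: "bilinear (gmet L i p) \<and> (\<forall>u v. gmet L i p u v = gmet L i p v u)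
      \<and> (\<forall>u. u \<noteq> 0 \<longrightarrow> gmet L i p u u > 0)" if "p \<in> cdom L i" for p
    using riem i that unfolding riemannian_manifold_def by blast
  fix x u v
  show "open (cimg L i)" by (rule open_cimg)
  show "Ck_on 2 (cimg L i) (\<lambda>x. coord_metric_of L i x u v)"
    using riem i by (auto simp: riemannian_manifold_def smooth_on_def)
  assume x: "x \<in> cimg L i"
  show "bilinear (coord_metric_of L i x)" using *[OF cinv_in[OF x]] by blast
  show "coord_metric_of L i x u v = coord_metric_of L i x v u" using *[OF cinv_in[OF x]] by blast
  show "0 < coord_metric_of L i x u u" if "u \<noteq> 0" using *[OF cinv_in[OF x]] that by blast
qed

lemma warped_coord: "warped_coord (cimg L i) (coord_metric_of L i) I f (deriv f)"
proof (intro warped_coord.intro coord_metric warped_coord_axioms.intro)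
  show "(f has_real_derivative deriv f t) (at t)" if "t \<in> I" for t
    by (rule smooth_on_has_real_derivative[OF smooth_f that])
qed (use open_I f_pos in auto)

lemma open_wchart_preimage:
  assumes "openin (mtop M) S"
  shows "open {z \<in> I \<times> cimg L i. wchart_inv i z \<in> S}"
proof -
  have o: "open (I \<times> cimg L i)" using open_I open_cimg by (rule open_Times)
  have t: "top_of_set (I \<times> cimg L i) = prod_topology (top_of_set I) (top_of_set (cimg L i))"
    by (simp add: subtopology_Times)
  have "continuous_map (top_of_set (I \<times> cimg L i)) (mtop M) (\<lambda>z. wchart_inv i z)"
    unfolding t warped_product_simps
    by (intro continuous_map_pairedI continuous_map_fst continuous_map_compose[OF continuous_map_snd continuous_cinv, unfolded comp_def])
  from openin_continuous_map_preimage[OF this assms]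
  have "openin (top_of_set (I \<times> cimg L i)) {z \<in> I \<times> cimg L i. wchart_inv i z \<in> S}" by simp
  then show ?thesis using openin_open_trans[OF _ o] by blast
qed

lemma openin_wchart_Times:
  assumes "open T" "open B"
  shows "openin (mtop M) {p \<in> I \<times> cdom L i. wchart i p \<in> T \<times> B}"
proof -
  have "openin (subtopology (mtop L) (cdom L i))
      {q \<in> topspace (subtopology (mtop L) (cdom L i)). cmap L i q \<in> cimg L i \<inter> B}"
    by (rule openin_continuous_map_preimage[OF continuous_cmap]) (use assms in \<open>auto intro: openin_open_Int\<close>)
  moreover have "{q \<in> topspace (subtopology (mtop L) (cdom L i)). cmap L i q \<in> cimg L i \<inter> B}
      = {q \<in> cdom L i. cmap L i q \<in> B}"
    unfolding topspace_cdom by auto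
  ultimately have "openin (mtop L) {q \<in> cdom L i. cmap L i q \<in> B}"
    using openin_trans_full[OF _ openin_cdom] by metis
  moreover have "openin (top_of_set I) (I \<inter> T)" using assms by auto
  ultimately have "openin (mtop M) ((I \<inter> T) \<times> {q \<in> cdom L i. cmap L i q \<in> B})"
    by (simp add: openin_prod_Times_iff)
  moreover have "(I \<inter> T) \<times> {q \<in> cdom L i. cmap L i q \<in> B} = {p \<in> I \<times> cdom L i. wchart i p \<in> T \<times> B}"
    by auto
  ultimately show ?thesis by simp
qed

lemma wchart_inv_wchart: "p \<in> I \<times> cdom L i \<Longrightarrow> wchart_inv i (wchart i p) = p"
  by (auto simp: cinv_cmap)

text \<open>Inverse charts are defined by \<open>inv_into\<close> on the chart domain, so
  restricting the manifold formally changes them. On the image of the smaller domain injectivity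
  makes them agree, and a single formula covers the product and its open subsets.\<close>

lemma inv_into_wchart:
  assumes "S \<subseteq> I \<times> cdom L i" "z \<in> cmap M i ` S"
  shows "inv_into S (cmap M i) z = wchart_inv i z"
proof -
  obtain p where p: "p \<in> S" "z = cmap M i p" using assms(2) by auto
  have "inj_on (cmap M i) S"
    using assms(1) wchart_inv_wchart by (intro inj_on_inverseI[of _ "wchart_inv i"]) auto
  then have "inv_into S (cmap M i) z = p" unfolding p(2) using p(1) by (rule inv_into_f_f)
  moreover have "wchart_inv i z = p"
    using wchart_inv_wchart[of p] p assms(1) by auto
  ultimately show ?thesis by simp
qed

lemma wchart_image:
  assumes "S \<subseteq> I \<times> cdom L i"
  shows "cmap M i ` S = {z \<in> I \<times> cimg L i. wchart_inv i z \<in> S}"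
proof (intro equalityI subsetI)
  fix z assume "z \<in> cmap M i ` S"
  then show "z \<in> {z \<in> I \<times> cimg L i. wchart_inv i z \<in> S}"
    using assms wchart_inv_wchart by auto
next
  fix z assume z: "z \<in> {z \<in> I \<times> cimg L i. wchart_inv i z \<in> S}"
  then have "z = cmap M i (wchart_inv i z)" by (auto simp: cmap_cinv)
  then show "z \<in> cmap M i ` S" using z by blast
qed

lemma gmet_wchart_inv: "gmet M i (wchart_inv i z) u v = warped_metric f (coord_metric_of L i) z u v"
  by (simp add: warped_metric_def)

end

end

section \<open>Vector fields on a Friedmann model\<close>

context grw
begin

lemma chart_deriv_eq:
  assumes i: "i \<in> idx L" and x: "x \<in> cimg L i"
  shows "chart_deriv L i F (cinv L i x) u = dd (\<lambda>y. F (cinv L i y)) x u"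
  by (simp add: chart_deriv_def o_def cmap_cinv[OF i x])

lemma christoffel_coord:
  assumes i: "i \<in> idx L" and x: "x \<in> cimg L i"
  shows "christoffel L i (cinv L i x) v w = coord_christoffel (coord_metric_of L i) x v w"
  unfolding christoffel_def coord_christoffel_def coord_koszul_def chart_deriv_eq[OF assms] ..

lemma sectional_curvature_coord:
  assumes i: "i \<in> idx L" and x: "x \<in> cimg L i"
  shows "sectional_curvature L i (cinv L i x) u v
    = coord_metric_of L i x (coord_curvature (coord_metric_of L i) x u v v) u
      / (coord_metric_of L i x u u * coord_metric_of L i x v v - (coord_metric_of L i x u v)\<^sup>2)"
proof -
  have "dd (\<lambda>y. christoffel L i (cinv L i y) v w) x u
      = dd (\<lambda>y. coord_christoffel (coord_metric_of L i) y v w) x u" for u v w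
    using dd_cong_open[OF open_cimg[OF i] x, of "\<lambda>y. christoffel L i (cinv L i y) v w"
        "\<lambda>y. coord_christoffel (coord_metric_of L i) y v w"] christoffel_coord[OF i] by simp
  then have "riemann_curvature L i (cinv L i x) u v v = coord_curvature (coord_metric_of L i) x u v v"
    unfolding riemann_curvature_def coord_curvature_def chart_deriv_eq[OF assms]
    by (simp add: christoffel_coord[OF assms])
  then show ?thesis by (simp add: sectional_curvature_def)
qed

end

section \<open>Charts of an open subset of a warped product\<close>

locale grw_open = grw I f L for I f and L :: "('l, 'e::euclidean_space, 'i) metric_manifold" +
  fixes \<Omega> :: "(real \<times> 'l) set"
  assumes open_\<Omega>: "openin (mtop (warped_product I f L)) \<Omega>"
begin

abbreviation "M\<Omega> \<equiv> open_submanifold M \<Omega>"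

lemma \<Omega>_subset: "\<Omega> \<subseteq> I \<times> topspace (mtop L)"
  using openin_subset[OF open_\<Omega>] by simp

lemma cdom_\<Omega>: "cdom M\<Omega> i = (I \<times> cdom L i) \<inter> \<Omega>"
  by simp

context
  fixes i assumes i: "i \<in> idx L"
begin

lemma openin_cdom_\<Omega>: "openin (mtop M) ((I \<times> cdom L i) \<inter> \<Omega>)"
proof -
  have "openin (mtop M) (I \<times> cdom L i)"
    using openin_cdom[OF i] by (simp add: openin_prod_Times_iff)
  then show ?thesis using open_\<Omega> by (rule openin_Int)
qed

lemma cimg_\<Omega>: "cimg M\<Omega> i = {z \<in> I \<times> cimg L i. wchart_inv i z \<in> (I \<times> cdom L i) \<inter> \<Omega>}"
  unfolding cdom_\<Omega> open_submanifold_simps(4) by (rule wchart_image[OF i]) blast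

lemma open_cimg_\<Omega>: "open (cimg M\<Omega> i)"
  unfolding cimg_\<Omega> by (rule open_wchart_preimage[OF i openin_cdom_\<Omega>])

lemma cinv_\<Omega>: "z \<in> cimg M\<Omega> i \<Longrightarrow> cinv M\<Omega> i z = wchart_inv i z"
  unfolding cinv_def[of M\<Omega>] cdom_\<Omega> open_submanifold_simps(4)
  by (rule inv_into_wchart[OF i]) blast

lemma wchart_inv_in_\<Omega>: "z \<in> cimg M\<Omega> i \<Longrightarrow> wchart_inv i z \<in> cdom M\<Omega> i"
  using cimg_\<Omega> cdom_\<Omega> by blast

lemma cmap_\<Omega>: "z \<in> cimg M\<Omega> i \<Longrightarrow> cmap M\<Omega> i (wchart_inv i z) = z"
  using cimg_\<Omega> cmap_cinv[OF i] by (auto simp del: open_submanifold_simps(3))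

lemma chart_deriv_\<Omega>:
  assumes z: "z \<in> cimg M\<Omega> i"
  shows "chart_deriv M\<Omega> i F (wchart_inv i z) u = dd (\<lambda>y. F (wchart_inv i y)) z u"
proof -
  have "dd (F \<circ> cinv M\<Omega> i) z = dd (\<lambda>y. F (wchart_inv i y)) z"
    by (rule dd_cong_open[OF open_cimg_\<Omega> z]) (simp add: cinv_\<Omega> del: open_submanifold_simps)
  then show ?thesis unfolding chart_deriv_def cmap_\<Omega>[OF z] by simp
qed

end

end

section \<open>Closed conformal fields on an open subset of a Friedmann model\<close>

locale friedmann = grw_open I f L \<Omega> for I f and L :: "('l, real ^ 3, 'i) metric_manifold" and \<Omega> +
  assumes Friedmann: "is_Friedmann I f L"
begin

lemma curvature_nondegenerate:
  obtains k where "\<And>i x u v. i \<in> idx L \<Longrightarrow> x \<in> cimg L i \<Longrightarrow> u \<noteq> v \<Longrightarrow> independent {u, v} \<Longrightarrow>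
      coord_metric_of L i x (coord_curvature (coord_metric_of L i) x u v v) u
      / (coord_metric_of L i x u u * coord_metric_of L i x v v - (coord_metric_of L i x u v)\<^sup>2) = k"
    and "\<And>t. t \<in> I \<Longrightarrow> (deriv f t)\<^sup>2 + k - f t * deriv (deriv f) t \<noteq> 0"
proof -
  obtain k A where k: "constant_sectional_curvature L k" and A: "A > 0"
      "\<And>t. t \<in> I \<Longrightarrow> (deriv f t)\<^sup>2 + k = A / f t" and nc: "\<not> f constant_on I"
    using Friedmann unfolding is_Friedmann_def by blast
  show ?thesis
  proof
    show "(deriv f t)\<^sup>2 + k - f t * deriv (deriv f) t \<noteq> 0" if "t \<in> I" for t
      by (rule Friedmann_nondegenerate[OF open_I interval_I smooth_f f_pos nc A that])
    fix i x and u v :: "real ^ 3"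
    assume a: "i \<in> idx L" "x \<in> cimg L i" "u \<noteq> v" "independent {u, v}"
    show "coord_metric_of L i x (coord_curvature (coord_metric_of L i) x u v v) u
      / (coord_metric_of L i x u u * coord_metric_of L i x v v - (coord_metric_of L i x u v)\<^sup>2) = k"
      unfolding sectional_curvature_coord[OF a(1,2), symmetric]
      using k a cinv_in[OF a(1,2)] unfolding constant_sectional_curvature_def by blast
  qed
qed

lemma deriv_deriv_f: "t \<in> I \<Longrightarrow> (deriv f has_real_derivative deriv (deriv f) t) (at t)"
  by (rule smooth_on_has_real_derivative[OF smooth_on_deriv[OF open_I smooth_f]])

context
  fixes V :: "'i \<Rightarrow> real \<times> 'l \<Rightarrow> real \<times> (real ^ 3)"
  assumes V: "smooth_vector_field M\<Omega> V" "closed_field M\<Omega> V" "conformal_field M\<Omega> V"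
begin

lemma V_closed_conformal:
  assumes i: "i \<in> idx L"
  shows "warped_closed_conformal (cimg L i) (coord_metric_of L i) I f (deriv f) (deriv (deriv f))
    (cimg M\<Omega> i) (\<lambda>z. V i (wchart_inv i z))"
proof (intro warped_closed_conformal.intro warped_coord i warped_closed_conformal_axioms.intro)
  let ?G = "warped_metric f (coord_metric_of L i)"
  have iM: "i \<in> idx M\<Omega>" using i by simp
  show "open (cimg M\<Omega> i)" by (rule open_cimg_\<Omega>[OF i])
  show "cimg M\<Omega> i \<subseteq> I \<times> cimg L i" unfolding cimg_\<Omega>[OF i] by blast
  show "Ck_on 2 (cimg M\<Omega> i) (\<lambda>z. V i (wchart_inv i z))"
  proof (rule Ck_on_cong[OF open_cimg_\<Omega>[OF i]])
    show "Ck_on 2 (cimg M\<Omega> i) (V i \<circ> cinv M\<Omega> i)"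
      using V(1) iM unfolding smooth_vector_field_def by (intro smooth_on_Ck) blast
    show "(V i \<circ> cinv M\<Omega> i) z = V i (wchart_inv i z)" if "z \<in> cimg M\<Omega> i" for z
      by (simp only: o_apply cinv_\<Omega>[OF i that])
  qed
  have gmet: "gmet M\<Omega> i (wchart_inv i y) u v = ?G y u v" for y u v
    by (simp only: open_submanifold_simps gmet_wchart_inv[OF i])
  fix z assume z: "z \<in> cimg M\<Omega> i"
  show "dd (\<lambda>z. ?G z (V i (wchart_inv i z)) v) z u = dd (\<lambda>z. ?G z (V i (wchart_inv i z)) u) z v" for u v
  proof -
    have "chart_deriv M\<Omega> i (\<lambda>q. gmet M\<Omega> i q (V i q) v) (wchart_inv i z) u
      - chart_deriv M\<Omega> i (\<lambda>q. gmet M\<Omega> i q (V i q) u) (wchart_inv i z) v = 0"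
      using V(2) iM wchart_inv_in_\<Omega>[OF i z] unfolding closed_field_def by blast
    then show ?thesis unfolding chart_deriv_\<Omega>[OF i z] gmet by simp
  qed
  obtain a where "\<And>u v. lie_deriv_metric M\<Omega> V i (wchart_inv i z) u v
      = 2 * a (wchart_inv i z) * gmet M\<Omega> i (wchart_inv i z) u v"
    using V(3) iM wchart_inv_in_\<Omega>[OF i z] unfolding conformal_field_def by blast
  then show "\<exists>a. \<forall>u v. dd (\<lambda>z. ?G z u v) z (V i (wchart_inv i z))
        + ?G z (dd (\<lambda>z. V i (wchart_inv i z)) z u) v + ?G z u (dd (\<lambda>z. V i (wchart_inv i z)) z v)
      = 2 * a * ?G z u v"
    unfolding lie_deriv_metric_def chart_deriv_\<Omega>[OF i z] gmet by blast
qed (rule deriv_deriv_f)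

lemma V_vertical:
  assumes i: "i \<in> idx L" and z: "z \<in> cimg M\<Omega> i"
  shows "snd (V i (wchart_inv i z)) = 0"
    and "((\<lambda>z. fst (V i (wchart_inv i z)) / f (fst z)) has_derivative (\<lambda>\<xi>. 0)) (at z)"
proof -
  interpret W: warped_closed_conformal "cimg L i" "coord_metric_of L i" I f "deriv f" "deriv (deriv f)"
    "cimg M\<Omega> i" "\<lambda>z. V i (wchart_inv i z)"
    by (rule V_closed_conformal[OF i])
  obtain k where k: "\<And>i x u v. i \<in> idx L \<Longrightarrow> x \<in> cimg L i \<Longrightarrow> u \<noteq> v \<Longrightarrow> independent {u, v} \<Longrightarrow>
      coord_metric_of L i x (coord_curvature (coord_metric_of L i) x u v v) u
      / (coord_metric_of L i x u u * coord_metric_of L i x v v - (coord_metric_of L i x u v)\<^sup>2) = k"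
    and nd: "\<And>t. t \<in> I \<Longrightarrow> (deriv f t)\<^sup>2 + k - f t * deriv (deriv f) t \<noteq> 0"
    using curvature_nondegenerate by blast
  have 0: "snd (V i (wchart_inv i z)) = 0" if "z \<in> cimg M\<Omega> i" for z
    by (rule W.W_eq_0[OF _ k[OF i] nd that]) simp_all
  show "snd (V i (wchart_inv i z)) = 0" by (rule 0[OF z])
  show "((\<lambda>z. fst (V i (wchart_inv i z)) / f (fst z)) has_derivative (\<lambda>\<xi>. 0)) (at z)"
    by (rule W.\<phi>_div_f_deriv[OF 0 z])
qed

text \<open>Transition maps between product charts are the identity in time, so their differentials
  leave the time component alone. This makes the quotient by \<open>f\<close> a function on \<Omega>
  rather than one per chart.\<close>

lemma fst_V_chart:
  assumes i: "i \<in> idx L" and j: "j \<in> idx L" and p: "p \<in> cdom M\<Omega> i \<inter> cdom M\<Omega> j"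
  shows "fst (V j p) = fst (V i p)"
proof -
  have pi: "p \<in> I \<times> cdom L i" "p \<in> cdom M\<Omega> i" and pj: "p \<in> I \<times> cdom L j" and p\<Omega>: "p \<in> \<Omega>"
    using p by auto
  let ?z = "wchart i p"
  have z: "?z \<in> cimg M\<Omega> i" using pi(2) by (force simp: image_iff)
  have pz: "wchart_inv i ?z = p" by (rule wchart_inv_wchart[OF i pi(1)])
  let ?F = "\<lambda>z. (fst z, cmap L j (cinv L i (snd z)))"
  have "smooth_on (cmap L i ` (cdom L i \<inter> cdom L j)) (cmap L j \<circ> cinv L i)"
    using manifold i j by (simp add: smooth_manifold_def)
  moreover have "cmap L i (snd p) \<in> cmap L i ` (cdom L i \<inter> cdom L j)" using pi pj by auto
  ultimately obtain D where D: "((\<lambda>x. cmap L j (cinv L i x)) has_derivative D) (at (snd ?z))"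
    using smooth_on_has_derivative unfolding comp_def by fastforce
  have "(?F has_derivative (\<lambda>\<xi>. (fst \<xi>, D (snd \<xi>)))) (at ?z)"
    by (intro has_derivative_Pair has_derivative_fst has_derivative_ident
        has_derivative_compose[OF has_derivative_snd[OF has_derivative_ident] D])
  then have F: "dd ?F ?z = (\<lambda>\<xi>. (fst \<xi>, D (snd \<xi>)))" by (rule dd_eqI)
  have "V j p = differential M\<Omega> M\<Omega> id i j p (V i p)"
    using V(1) i j p unfolding smooth_vector_field_def by (simp only: open_submanifold_simps warped_product_simps)
  also have "\<dots> = dd ?F ?z (V i p)"
    using chart_deriv_\<Omega>[OF i z, of "cmap M\<Omega> j \<circ> id" "V i p"] unfolding pz differential_def by simp
  finally show ?thesis by (simp add: F)
qed

lemma V_multiple: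
  assumes conn: "connectedin (mtop M) \<Omega>"
  shows "\<exists>c. \<forall>i\<in>idx M. \<forall>p\<in>cdom M i \<inter> \<Omega>. V i p = c *\<^sub>R f_dt f i p"
proof (cases "\<Omega> = {}")
  case False
  \<comment> \<open>A chart is chosen arbitrarily at each point; \<open>fst_V_chart\<close> makes
    the value independent of the choice, so \<open>c\<close> can be computed in any chart when its
    local constancy is shown.\<close>
  define c where "c p = fst (V (SOME i. i \<in> idx L \<and> snd p \<in> cdom L i) p) / f (fst p)" for p
  have chart: "\<exists>i. i \<in> idx L \<and> snd p \<in> cdom L i" if "p \<in> \<Omega>" for p
    using \<Omega>_subset that unfolding topspace_L by (cases p) auto
  have c: "c p = fst (V i p) / f (fst p)" if "i \<in> idx L" "p \<in> cdom M\<Omega> i" for i p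
  proof -
    have p: "p \<in> \<Omega>" "fst p \<in> I" using that by auto
    have s: "(SOME i. i \<in> idx L \<and> snd p \<in> cdom L i) \<in> idx L"
        "snd p \<in> cdom L (SOME i. i \<in> idx L \<and> snd p \<in> cdom L i)"
      using someI_ex[OF chart[OF p(1)]] by auto
    then have "p \<in> cdom M\<Omega> (SOME i. i \<in> idx L \<and> snd p \<in> cdom L i)" using p by (cases p) auto
    then show ?thesis unfolding c_def using fst_V_chart[OF that(1) s(1), of p] that(2) by simp
  qed
  have loc: "\<exists>T. openin (mtop M) T \<and> p \<in> T \<and> (\<forall>q\<in>T \<inter> \<Omega>. c q = c p)" if p: "p \<in> \<Omega>" for p
  proof -
    obtain i where i: "i \<in> idx L" "snd p \<in> cdom L i" using chart[OF p] by blast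
    have pi: "p \<in> cdom M\<Omega> i" "p \<in> I \<times> cdom L i" using i p \<Omega>_subset by (cases p; auto)+
    let ?z = "wchart i p"
    have z: "?z \<in> cimg M\<Omega> i" using pi(1) by (force simp: image_iff)
    obtain A B where AB: "open A" "open B" "?z \<in> A \<times> B" "A \<times> B \<subseteq> cimg M\<Omega> i"
      using open_cimg_\<Omega>[OF i(1)] z by (rule open_prod_elim)
    then obtain a b where ab: "a > 0" "ball (fst ?z) a \<subseteq> A" "b > 0" "ball (snd ?z) b \<subseteq> B"
      by (metis SigmaE fst_conv openE snd_conv)
    let ?A = "ball (fst ?z) a" and ?B = "ball (snd ?z) b"
    have sub: "?A \<times> ?B \<subseteq> cimg M\<Omega> i" using AB(4) ab by blast
    let ?T = "{q \<in> I \<times> cdom L i. wchart i q \<in> ?A \<times> ?B}"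
    have "openin (mtop M) ?T" by (rule openin_wchart_Times[OF i(1)]) auto
    moreover have "p \<in> ?T" using pi ab by auto
    moreover have "c q = c p" if q: "q \<in> ?T" for q
    proof -
      let ?h = "\<lambda>z. fst (V i (wchart_inv i z)) / f (fst z)"
      have qT: "q \<in> I \<times> cdom L i" "wchart i q \<in> ?A \<times> ?B" using q by blast+
      \<comment> \<open>A product of balls is convex, so the vanishing derivative gives constancy on
        the whole neighbourhood.\<close>
      have "?h (wchart i q) = ?h ?z"
      proof (rule has_derivative_zero_unique[of "?A \<times> ?B"])
        show "convex (?A \<times> ?B)" by (intro convex_Times convex_ball)
        show "(?h has_derivative (\<lambda>h. 0)) (at y within ?A \<times> ?B)" if "y \<in> ?A \<times> ?B" for y
          using V_vertical(2)[OF i(1)] sub that by (blast intro: has_derivative_at_withinI)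
        show "?z \<in> ?A \<times> ?B" using ab by simp
      qed (rule qT(2))
      moreover have "?h (wchart i q) = c q"
      proof -
        have "wchart i q \<in> cimg M\<Omega> i" using sub qT(2) by blast
        from wchart_inv_in_\<Omega>[OF i(1) this] have "q \<in> cdom M\<Omega> i"
          unfolding wchart_inv_wchart[OF i(1) qT(1)] .
        then show ?thesis unfolding wchart_inv_wchart[OF i(1) qT(1)] by (simp only: c[OF i(1)] fst_conv)
      qed
      moreover have "?h ?z = c p"
        unfolding wchart_inv_wchart[OF i(1) pi(2)] by (simp only: c[OF i(1) pi(1)] fst_conv)
      ultimately show ?thesis by simp
    qed
    ultimately show ?thesis by blast
  qed
  obtain p0 where p0: "p0 \<in> \<Omega>" using False by blast
  have "V i p = c p0 *\<^sub>R f_dt f i p" if "i \<in> idx M" "p \<in> cdom M i \<inter> \<Omega>" for i p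
  proof -
    have i: "i \<in> idx L" and p: "p \<in> cdom M\<Omega> i" "p \<in> \<Omega>" "p \<in> I \<times> cdom L i" using that by auto
    have "c p = c p0" by (rule connectedin_locally_constant[OF conn loc p0 p(2)])
    then have "fst (V i p) / f (fst p) = c p0" using c[OF i p(1)] by simp
    moreover have "0 < f (fst p)" using f_pos p(3) by auto
    ultimately have 1: "fst (V i p) = c p0 * f (fst p)" by (simp add: divide_eq_eq)
    have "wchart i p \<in> cimg M\<Omega> i" using p(1) by (force simp: image_iff)
    from V_vertical(1)[OF i this] have "snd (V i p) = 0"
      using wchart_inv_wchart[OF i p(3)] by simp
    with 1 show ?thesis by (simp add: f_dt_def prod_eq_iff split_beta)
  qed
  then show ?thesis by blast
qed simp

end

end

section \<open>Foliations\<close>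

lemma smooth_on_cong: "open S \<Longrightarrow> smooth_on S f \<Longrightarrow> (\<And>x. x \<in> S \<Longrightarrow> f x = g x) \<Longrightarrow> smooth_on S g"
  unfolding smooth_on_def using Ck_on_cong by blast

text \<open>Stated for a map between two arbitrary warped products, so that it applies to an
  isometry and to its inverse. On a product of balls the time lines and slices are convex, and the
  vanishing parts of the differential make the matching component constant along them; injectivity
  of the target chart transfers this to points.\<close>

lemma local_leaves:
  fixes L :: "('l, 'e::euclidean_space, 'i) metric_manifold"
    and N :: "('n, 'd::euclidean_space, 'j) metric_manifold" and \<eta> :: "real \<times> 'l \<Rightarrow> real \<times> 'n"
  assumes L: "grw I f L" and N: "grw J h N" and i: "i \<in> idx L" and j: "j \<in> idx N"
    and D: "D \<subseteq> I \<times> cdom L i" and Q: "Q = cmap (warped_product I f L) i ` D" "open Q"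
    and F: "\<And>z. z \<in> Q \<Longrightarrow> (F has_derivative dd F z) (at z)"
      "\<And>z. z \<in> Q \<Longrightarrow> snd (dd F z (1, 0)) = 0" "\<And>z v. z \<in> Q \<Longrightarrow> fst (dd F z (0, v)) = 0"
    and \<eta>: "\<And>p. p \<in> D \<Longrightarrow> \<eta> p \<in> J \<times> cdom N j"
      "\<And>p. p \<in> D \<Longrightarrow> F (fst p, cmap L i (snd p)) = (fst (\<eta> p), cmap N j (snd (\<eta> p)))"
    and p: "p \<in> D"
  shows "\<exists>T. openin (mtop (warped_product I f L)) T \<and> p \<in> T \<and>
    (\<forall>q\<in>T. (snd q = snd p \<longrightarrow> snd (\<eta> q) = snd (\<eta> p)) \<and> (fst q = fst p \<longrightarrow> fst (\<eta> q) = fst (\<eta> p)))"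
proof -
  interpret L: grw I f L by fact
  interpret N: grw J h N by fact
  have Q_eq: "Q = {z \<in> I \<times> cimg L i. L.wchart_inv i z \<in> D}"
    unfolding Q(1) by (rule L.wchart_image[OF i D])
  have pI: "p \<in> I \<times> cdom L i" using p D by blast
  have "cmap (warped_product I f L) i p \<in> Q" using p Q(1) by blast
  then have zQ: "L.wchart i p \<in> Q" by simp
  obtain A B where AB: "open A" "open B" "L.wchart i p \<in> A \<times> B" "A \<times> B \<subseteq> Q"
    using Q(2) zQ by (rule open_prod_elim)
  then have "fst p \<in> A" "cmap L i (snd p) \<in> B" by auto
  then obtain a b where ab: "a > 0" "ball (fst p) a \<subseteq> A" "b > 0" "ball (cmap L i (snd p)) b \<subseteq> B"
    using AB(1,2) by (metis openE)
  let ?A = "ball (fst p) a" and ?B = "ball (cmap L i (snd p)) b"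
  have sub: "?A \<times> ?B \<subseteq> Q" using AB(4) ab by blast
  let ?T = "{q \<in> I \<times> cdom L i. L.wchart i q \<in> ?A \<times> ?B}"
  have "openin (mtop (warped_product I f L)) ?T" by (rule L.openin_wchart_Times[OF i]) auto
  moreover have "p \<in> ?T" using pI ab by auto
  moreover have "(snd q = snd p \<longrightarrow> snd (\<eta> q) = snd (\<eta> p)) \<and> (fst q = fst p \<longrightarrow> fst (\<eta> q) = fst (\<eta> p))"
    if q: "q \<in> ?T" for q
  proof -
    have qI: "q \<in> I \<times> cdom L i" and qAB: "L.wchart i q \<in> ?A \<times> ?B" using q by blast+
    have "L.wchart_inv i (L.wchart i q) \<in> D" using qAB sub Q_eq by blast
    then have qD: "q \<in> D" unfolding L.wchart_inv_wchart[OF i qI] .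
    have qA: "fst q \<in> ?A" "cmap L i (snd q) \<in> ?B" using qAB by auto
    have pA: "fst p \<in> ?A" "cmap L i (snd p) \<in> ?B" using ab by auto
    have 1: "snd (\<eta> q) = snd (\<eta> p)" if eq: "snd q = snd p"
    proof -
      have "snd (F (fst q, cmap L i (snd p))) = snd (F (fst p, cmap L i (snd p)))"
        by (rule snd_constant_along_time[OF convex_ball F(1,2) qA(1) pA(1)]) (use sub pA(2) in blast)+
      then have "cmap N j (snd (\<eta> q)) = cmap N j (snd (\<eta> p))"
        using \<eta>(2)[OF qD] \<eta>(2)[OF p] eq by simp
      moreover have "snd (\<eta> q) \<in> cdom N j" "snd (\<eta> p) \<in> cdom N j"
        using \<eta>(1)[OF qD] \<eta>(1)[OF p] by auto
      ultimately show ?thesis using N.inj_cmap[OF j] by (simp add: inj_on_eq_iff)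
    qed
    have 2: "fst (\<eta> q) = fst (\<eta> p)" if eq: "fst q = fst p"
    proof -
      have "fst (F (fst p, cmap L i (snd q))) = fst (F (fst p, cmap L i (snd p)))"
        by (rule fst_constant_along_space[OF convex_ball F(1,3) qA(2) pA(2)]) (use sub pA(1) in blast)+
      then show ?thesis using \<eta>(2)[OF qD] \<eta>(2)[OF p] eq by simp
    qed
    show ?thesis using 1 2 by blast
  qed
  ultimately show ?thesis by blast
qed

text \<open>Presents the leaves as fibres of a projection, as \<open>leaves_correspond\<close>
  expects. For empty \<open>I\<close> the left side could contain an empty leaf, but the right side
  would contain none; the slice version has the same concern about \<open>L\<close>.\<close>

lemma time_foliation_eq:
  assumes "I \<noteq> {}"
  shows "time_foliation I L = {{p \<in> topspace (mtop (warped_product I f L)). snd p = x} | x.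
    x \<in> snd ` topspace (mtop (warped_product I f L))}"
proof -
  have "{p \<in> I \<times> topspace (mtop L). snd p = x} = I \<times> {x}" if "x \<in> topspace (mtop L)" for x
    using that by auto
  moreover have "snd ` (I \<times> topspace (mtop L)) = topspace (mtop L)" using assms by simp
  ultimately show ?thesis by (auto simp: time_foliation_def)
qed

lemma slice_foliation_eq:
  assumes "topspace (mtop L) \<noteq> {}"
  shows "slice_foliation I L = {{p \<in> topspace (mtop (warped_product I f L)). fst p = t} | t.
    t \<in> fst ` topspace (mtop (warped_product I f L))}"
proof -
  have "{p \<in> I \<times> topspace (mtop L). fst p = t} = {t} \<times> topspace (mtop L)" if "t \<in> I" for t
    using that by auto
  moreover have "fst ` (I \<times> topspace (mtop L)) = I" using assms by simp
  ultimately show ?thesis by (auto simp: slice_foliation_def)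
qed

section \<open>Isometries of an open subset of a Friedmann model onto a GRW space\<close>

locale friedmann_isometry = friedmann I f L \<Omega> + N: grw J h N
  for I f and L :: "('l, real ^ 3, 'i) metric_manifold" and \<Omega> J h
    and N :: "('n, 'e::euclidean_space, 'j) metric_manifold" +
  fixes \<phi> \<psi>
  assumes smooth_\<phi>: "smooth_map M\<Omega> N.M \<phi>" and smooth_\<psi>: "smooth_map N.M M\<Omega> \<psi>"
    and \<psi>\<phi>: "p \<in> \<Omega> \<Longrightarrow> \<psi> (\<phi> p) = p" and \<phi>\<psi>: "q \<in> topspace (mtop N.M) \<Longrightarrow> \<phi> (\<psi> q) = q"
    and gmet_\<phi>: "i \<in> idx L \<Longrightarrow> j \<in> idx N \<Longrightarrow> p \<in> cdom M\<Omega> i \<Longrightarrow> \<phi> p \<in> cdom N.M j \<Longrightarrow>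
      gmet M\<Omega> i p u v = gmet N.M j (\<phi> p) (differential M\<Omega> N.M \<phi> i j p u) (differential M\<Omega> N.M \<phi> i j p v)"
begin

lemma continuous_\<phi>: "continuous_map (subtopology (mtop M) \<Omega>) (mtop N.M) \<phi>"
  and continuous_\<psi>: "continuous_map (mtop N.M) (subtopology (mtop M) \<Omega>) \<psi>"
  using smooth_\<phi> smooth_\<psi> unfolding smooth_map_def open_submanifold_simps by blast+

text \<open>For charts of the two atlases, \<open>D\<close> is the region where both can be used,
  \<open>D'\<close> is its image under \<phi>, \<open>Q\<close> and \<open>Q'\<close> are their
  coordinate images, and \<open>F\<close> and \<open>P\<close> are the coordinate forms of \<phi>
  and \<psi>.\<close>

definition "D i j = {p \<in> cdom M\<Omega> i. \<phi> p \<in> cdom N.M j}"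
definition "D' i j = {q \<in> cdom N.M j. \<psi> q \<in> cdom M\<Omega> i}"
definition "Q i j = cmap M\<Omega> i ` D i j"
definition "Q' i j = cmap N.M j ` D' i j"
definition "F i j z = N.wchart j (\<phi> (wchart_inv i z))"
definition "P i j y = wchart i (\<psi> (N.wchart_inv j y))"

context
  fixes i j assumes i: "i \<in> idx L" and j: "j \<in> idx N"
begin

lemma D_subset: "D i j \<subseteq> I \<times> cdom L i" and D'_subset: "D' i j \<subseteq> J \<times> cdom N j"
  unfolding D_def D'_def by auto

lemma Q_eq: "Q i j = {z \<in> I \<times> cimg L i. wchart_inv i z \<in> D i j}"
  unfolding Q_def open_submanifold_simps(4) by (rule wchart_image[OF i D_subset])

lemma Q'_eq: "Q' i j = {y \<in> J \<times> cimg N j. N.wchart_inv j y \<in> D' i j}"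
  unfolding Q'_def by (rule N.wchart_image[OF j D'_subset])

lemma Q_subset: "Q i j \<subseteq> cimg M\<Omega> i"
  unfolding Q_def D_def by blast

lemma open_Q: "open (Q i j)"
proof -
  have o: "openin (subtopology (mtop M) \<Omega>) (cdom M\<Omega> i)"
    unfolding openin_open_subtopology[OF open_\<Omega>] cdom_\<Omega> using openin_cdom_\<Omega>[OF i] by blast
  have "openin (mtop N.M) (cdom N.M j)"
    using N.openin_cdom[OF j] by (simp add: openin_prod_Times_iff)
  from openin_continuous_map_preimage_gen[OF continuous_\<phi> o this]
  have "openin (mtop M) (D i j)"
    unfolding D_def using openin_trans_full[OF _ open_\<Omega>] by blast
  then show ?thesis unfolding Q_eq by (rule open_wchart_preimage[OF i])
qed

lemma open_Q': "open (Q' i j)"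
proof -
  have o: "openin (subtopology (mtop M) \<Omega>) (cdom M\<Omega> i)"
    unfolding openin_open_subtopology[OF open_\<Omega>] cdom_\<Omega> using openin_cdom_\<Omega>[OF i] by blast
  have "openin (mtop N.M) (cdom N.M j)"
    using N.openin_cdom[OF j] by (simp add: openin_prod_Times_iff)
  from openin_continuous_map_preimage_gen[OF continuous_\<psi> this o]
  have "openin (mtop N.M) (D' i j)" unfolding D'_def .
  then show ?thesis unfolding Q'_eq by (rule N.open_wchart_preimage[OF j])
qed

lemma D_\<phi>: "p \<in> D i j \<Longrightarrow> \<phi> p \<in> D' i j" and D_\<Omega>: "p \<in> D i j \<Longrightarrow> p \<in> \<Omega>"
  using \<psi>\<phi> unfolding D_def D'_def by auto

lemma D'_topspace: "q \<in> D' i j \<Longrightarrow> q \<in> topspace (mtop N.M)"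
  using N.openin_cdom[OF j] openin_subset unfolding D'_def by fastforce

lemma D'_\<psi>: "q \<in> D' i j \<Longrightarrow> \<psi> q \<in> D i j"
  using \<phi>\<psi>[OF D'_topspace] unfolding D_def D'_def by auto

lemma F_wchart: "p \<in> D i j \<Longrightarrow> F i j (wchart i p) = N.wchart j (\<phi> p)"
  unfolding F_def using wchart_inv_wchart[OF i, of p] D_subset by auto

lemma P_wchart: "q \<in> D' i j \<Longrightarrow> P i j (N.wchart j q) = wchart i (\<psi> q)"
  unfolding P_def using N.wchart_inv_wchart[OF j, of q] D'_subset by auto

lemma warped_isometry_charts:
  "warped_isometry (cimg L i) (coord_metric_of L i) I f (deriv f)
    (cimg N j) (coord_metric_of N j) J h (deriv h) (deriv (deriv f)) (Q i j) (Q' i j) (F i j) (P i j)"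
proof (intro warped_isometry.intro warped_coord N.warped_coord i j warped_isometry_axioms.intro)
  have Qp: "\<exists>p\<in>D i j. z = wchart i p" if "z \<in> Q i j" for z using that unfolding Q_def by auto
  have Q'q: "\<exists>q\<in>D' i j. y = N.wchart j q" if "y \<in> Q' i j" for y using that unfolding Q'_def by auto
  have in_Q: "wchart i p \<in> Q i j" if "p \<in> D i j" for p using that unfolding Q_def by force
  have in_Q': "N.wchart j q \<in> Q' i j" if "q \<in> D' i j" for q using that unfolding Q'_def by force
  show "smooth_on J h" by (rule N.smooth_f)
  show "open (Q i j)" by (rule open_Q)
  show "open (Q' i j)" by (rule open_Q')
  show "Q i j \<subseteq> I \<times> cimg L i" unfolding Q_eq by blast
  show "Q' i j \<subseteq> J \<times> cimg N j" unfolding Q'_eq by blast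
  show "F i j ` Q i j \<subseteq> Q' i j"
    using Qp F_wchart in_Q'[OF D_\<phi>] by fastforce
  show "P i j ` Q' i j \<subseteq> Q i j"
    using Q'q P_wchart in_Q[OF D'_\<psi>] by fastforce
  show "P i j (F i j z) = z" if "z \<in> Q i j" for z
    using Qp[OF that] F_wchart P_wchart[OF D_\<phi>] \<psi>\<phi>[OF D_\<Omega>] by auto
  show "F i j (P i j y) = y" if "y \<in> Q' i j" for y
    using Q'q[OF that] P_wchart F_wchart[OF D'_\<psi>] \<phi>\<psi>[OF D'_topspace] by auto
  show "smooth_on (Q i j) (F i j)"
  proof (rule smooth_on_cong[OF open_Q])
    show "smooth_on (Q i j) (cmap N.M j \<circ> \<phi> \<circ> cinv M\<Omega> i)"
      using smooth_\<phi> i j unfolding smooth_map_def Q_def D_def by simp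
    show "(cmap N.M j \<circ> \<phi> \<circ> cinv M\<Omega> i) z = F i j z" if "z \<in> Q i j" for z
      using cinv_\<Omega>[OF i subsetD[OF Q_subset that]] by (simp add: F_def)
  qed
  show "smooth_on (Q' i j) (P i j)"
  proof (rule smooth_on_cong[OF open_Q'])
    show "smooth_on (Q' i j) (cmap M\<Omega> i \<circ> \<psi> \<circ> cinv N.M j)"
      using smooth_\<psi> i j unfolding smooth_map_def Q'_def D'_def by simp
    show "(cmap M\<Omega> i \<circ> \<psi> \<circ> cinv N.M j) y = P i j y" if "y \<in> Q' i j" for y
    proof -
      have "y \<in> cmap N.M j ` (J \<times> cdom N j)" using that D'_subset unfolding Q'_def by blast
      then have "cinv N.M j y = N.wchart_inv j y"
        unfolding cinv_def[of N.M] warped_product_simps(3) by (rule N.inv_into_wchart[OF j subset_refl])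
      then show ?thesis by (simp add: P_def)
    qed
  qed
  show "warped_metric f (coord_metric_of L i) z u v
      = warped_metric h (coord_metric_of N j) (F i j z) (dd (F i j) z u) (dd (F i j) z v)"
    if z: "z \<in> Q i j" for z u v
  proof -
    have zc: "z \<in> cimg M\<Omega> i" using Q_subset z by blast
    have p: "wchart_inv i z \<in> D i j" using z unfolding Q_eq by blast
    have diff: "differential M\<Omega> N.M \<phi> i j (wchart_inv i z) w = dd (F i j) z w" for w
      unfolding differential_def chart_deriv_\<Omega>[OF i zc] by (simp add: F_def[abs_def])
    have \<phi>p: "\<phi> (wchart_inv i z) = N.wchart_inv j (F i j z)"
      unfolding F_def using N.wchart_inv_wchart[OF j, of "\<phi> (wchart_inv i z)"] D_\<phi>[OF p] D'_subset
      by (metis subsetD)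
    have "gmet M\<Omega> i (wchart_inv i z) u v
        = gmet N.M j (\<phi> (wchart_inv i z)) (dd (F i j) z u) (dd (F i j) z v)"
      using gmet_\<phi>[OF i j, of "wchart_inv i z" u v] p unfolding D_def diff by blast
    then show ?thesis
      unfolding \<phi>p N.gmet_wchart_inv[OF j] open_submanifold_simps(5) gmet_wchart_inv[OF i] .
  qed
qed (rule deriv_deriv_f)

lemma local_leaves_\<phi>:
  assumes "p \<in> D i j"
  shows "\<exists>T. openin (mtop M) T \<and> p \<in> T \<and>
    (\<forall>q\<in>T. (snd q = snd p \<longrightarrow> snd (\<phi> q) = snd (\<phi> p)) \<and> (fst q = fst p \<longrightarrow> fst (\<phi> q) = fst (\<phi> p)))"
    and local_leaves_\<psi>: "\<exists>T. openin (mtop N.M) T \<and> \<phi> p \<in> T \<and>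
    (\<forall>q\<in>T. (snd q = snd (\<phi> p) \<longrightarrow> snd (\<psi> q) = snd (\<psi> (\<phi> p))) \<and>
      (fst q = fst (\<phi> p) \<longrightarrow> fst (\<psi> q) = fst (\<psi> (\<phi> p))))"
proof -
  interpret W: warped_isometry "cimg L i" "coord_metric_of L i" I f "deriv f"
    "cimg N j" "coord_metric_of N j" J h "deriv h" "deriv (deriv f)" "Q i j" "Q' i j" "F i j" "P i j"
    by (rule warped_isometry_charts)
  obtain k where k: "\<And>i x u v. i \<in> idx L \<Longrightarrow> x \<in> cimg L i \<Longrightarrow> u \<noteq> v \<Longrightarrow> independent {u, v} \<Longrightarrow>
      coord_metric_of L i x (coord_curvature (coord_metric_of L i) x u v v) u
      / (coord_metric_of L i x u u * coord_metric_of L i x v v - (coord_metric_of L i x u v)\<^sup>2) = k"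
    and nd: "\<And>t. t \<in> I \<Longrightarrow> (deriv f t)\<^sup>2 + k - f t * deriv (deriv f) t \<noteq> 0"
    using curvature_nondegenerate by blast
  have n: "2 \<le> CARD(3)" by simp
  show "\<exists>T. openin (mtop M) T \<and> p \<in> T \<and>
    (\<forall>q\<in>T. (snd q = snd p \<longrightarrow> snd (\<phi> q) = snd (\<phi> p)) \<and> (fst q = fst p \<longrightarrow> fst (\<phi> q) = fst (\<phi> p)))"
  proof (rule local_leaves[OF grw_axioms N.grw_axioms i j D_subset])
    show "Q i j = cmap M i ` D i j" by (simp add: Q_def)
    show "open (Q i j)" by (rule open_Q)
    show "(F i j has_derivative dd (F i j) z) (at z)" if "z \<in> Q i j" for z
      by (rule smooth_on_has_derivative[OF W.smooth_F that])
    show "snd (dd (F i j) z (1, 0)) = 0" if "z \<in> Q i j" for z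
      by (rule W.snd_dd_F_time[OF n k[OF i] nd that])
    show "fst (dd (F i j) z (0, v)) = 0" if "z \<in> Q i j" for z v
      by (rule W.fst_dd_F_space[OF n k[OF i] nd that])
    show "\<phi> p \<in> J \<times> cdom N j" if "p \<in> D i j" for p using D_\<phi>[OF that] D'_subset by blast
    show "F i j (wchart i p) = N.wchart j (\<phi> p)" if "p \<in> D i j" for p by (rule F_wchart[OF that])
    show "p \<in> D i j" by fact
  qed
  show "\<exists>T. openin (mtop N.M) T \<and> \<phi> p \<in> T \<and>
    (\<forall>q\<in>T. (snd q = snd (\<phi> p) \<longrightarrow> snd (\<psi> q) = snd (\<psi> (\<phi> p))) \<and>
      (fst q = fst (\<phi> p) \<longrightarrow> fst (\<psi> q) = fst (\<psi> (\<phi> p))))"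
  \<comment> \<open>The two spaces exchange roles. The facts about \<open>P\<close> come from the
    vertical pulled-back field and orthogonality, not from any curvature of the target.\<close>
  proof (rule local_leaves[OF N.grw_axioms grw_axioms j i D'_subset])
    show "Q' i j = cmap N.M j ` D' i j" by (simp add: Q'_def)
    show "open (Q' i j)" by (rule open_Q')
    show "(P i j has_derivative dd (P i j) z) (at z)" if "z \<in> Q' i j" for z
      by (rule smooth_on_has_derivative[OF W.smooth_P that])
    show "snd (dd (P i j) z (1, 0)) = 0" if "z \<in> Q' i j" for z
      by (rule W.snd_dd_P_time[OF n k[OF i] nd that])
    show "fst (dd (P i j) z (0, v)) = 0" if "z \<in> Q' i j" for z v
      by (rule W.fst_dd_P_space[OF n k[OF i] nd that])
    show "\<psi> q \<in> I \<times> cdom L i" if "q \<in> D' i j" for q using D'_\<psi>[OF that] D_subset by blast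
    show "P i j (N.wchart j q) = wchart i (\<psi> q)" if "q \<in> D' i j" for q by (rule P_wchart[OF that])
    show "\<phi> p \<in> D' i j" by (rule D_\<phi>) fact
  qed
qed

end

lemma \<phi>_in: "p \<in> \<Omega> \<Longrightarrow> \<phi> p \<in> topspace (mtop N.M)"
  using continuous_map_image_subset_topspace[OF continuous_\<phi>] openin_subset[OF open_\<Omega>] by auto

lemma \<psi>_in: "q \<in> topspace (mtop N.M) \<Longrightarrow> \<psi> q \<in> \<Omega>"
  using continuous_map_image_subset_topspace[OF continuous_\<psi>] by auto

lemma charts:
  assumes "p \<in> \<Omega>"
  obtains i j where "i \<in> idx L" "j \<in> idx N" "p \<in> D i j"
proof -
  have "snd p \<in> topspace (mtop L)" "fst p \<in> I" using \<Omega>_subset assms by auto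
  moreover have "snd (\<phi> p) \<in> topspace (mtop N)" "fst (\<phi> p) \<in> J" using \<phi>_in[OF assms] by auto
  ultimately obtain i j where "i \<in> idx L" "snd p \<in> cdom L i" "j \<in> idx N" "snd (\<phi> p) \<in> cdom N j"
    using topspace_L N.topspace_L by blast
  then show ?thesis
    using that[of i j] assms \<open>fst p \<in> I\<close> \<open>fst (\<phi> p) \<in> J\<close> by (auto simp: D_def mem_Times_iff)
qed

lemma foliations_correspond:
  assumes ne: "\<Omega> \<noteq> {}"
  shows "(`) \<phi> ` restrict_foliation (mtop M) (time_foliation I L) \<Omega> = time_foliation J N"
    and "(`) \<phi> ` restrict_foliation (mtop M) (slice_foliation I L) \<Omega> = slice_foliation J N"
proof -
  obtain p0 where p0: "p0 \<in> \<Omega>" using ne by blast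
  have neL: "topspace (mtop L) \<noteq> {}" using p0 \<Omega>_subset by auto
  have neN: "topspace (mtop N) \<noteq> {}" using \<phi>_in[OF p0] by auto
  have loc\<phi>: "\<exists>T. openin (mtop M) T \<and> p \<in> T \<and> (\<forall>q\<in>T. (snd q = snd p \<longrightarrow> snd (\<phi> q) = snd (\<phi> p))
      \<and> (fst q = fst p \<longrightarrow> fst (\<phi> q) = fst (\<phi> p)))" if "p \<in> \<Omega>" for p
    using charts[OF that] local_leaves_\<phi> by metis
  \<comment> \<open>Every target point \<open>q\<close> is the image of the point \<psi> q of
    \<Omega>, so the neighbourhood found around images covers all cases.\<close>
  have loc\<psi>: "\<exists>T. openin (mtop N.M) T \<and> q \<in> T \<and> (\<forall>r\<in>T. (snd r = snd q \<longrightarrow> snd (\<psi> r) = snd (\<psi> q))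
      \<and> (fst r = fst q \<longrightarrow> fst (\<psi> r) = fst (\<psi> q)))" if q: "q \<in> topspace (mtop N.M)" for q
    using charts[OF \<psi>_in[OF q]] local_leaves_\<psi>[of _ _ "\<psi> q"] unfolding \<phi>\<psi>[OF q] by metis
  have \<Omega>: "\<Omega> \<subseteq> topspace (mtop M)" using openin_subset[OF open_\<Omega>] .
  note corr = leaves_correspond[OF continuous_\<phi> continuous_\<psi> \<Omega> \<psi>\<phi> \<phi>\<psi>]
  \<comment> \<open>Whole time lines of the target are connected because \<open>J\<close> is an
    interval; this lets them match single components rather than unions of components.\<close>
  have "connectedin (mtop N.M) (J \<times> {x})" if "x \<in> topspace (mtop N)" for x
    using that N.interval_I by (simp add: connectedin_Times is_interval_connected)
  moreover have "{r \<in> topspace (mtop N.M). snd r = snd q} = J \<times> {snd q}"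
    if "q \<in> topspace (mtop N.M)" for q using that by auto
  ultimately have "connectedin (mtop N.M) {r \<in> topspace (mtop N.M). snd r = snd q}"
    if "q \<in> topspace (mtop N.M)" for q using that by auto
  then show "(`) \<phi> ` restrict_foliation (mtop M) (time_foliation I L) \<Omega> = time_foliation J N"
    unfolding time_foliation_eq[OF I_nonempty, of L f] time_foliation_eq[OF N.I_nonempty, of N h]
  proof (intro corr)
    show "\<exists>T. openin (mtop M) T \<and> p \<in> T \<and> (\<forall>q\<in>T \<inter> \<Omega>. snd q = snd p \<longrightarrow> snd (\<phi> q) = snd (\<phi> p))"
      if "p \<in> \<Omega>" for p using loc\<phi>[OF that] by (metis IntD1)
    show "\<exists>T. openin (mtop N.M) T \<and> q \<in> T \<and> (\<forall>r\<in>T. snd r = snd q \<longrightarrow> snd (\<psi> r) = snd (\<psi> q))"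
      if "q \<in> topspace (mtop N.M)" for q using loc\<psi>[OF that] by metis
  qed blast
  \<comment> \<open>The same role for the slices is played by connectedness of
    \<open>N\<close>.\<close>
  have "connectedin (mtop N.M) ({t} \<times> topspace (mtop N))" if "t \<in> J" for t
    using that N.connected_L by (simp add: connectedin_Times connectedin_topspace)
  moreover have "{r \<in> topspace (mtop N.M). fst r = fst q} = {fst q} \<times> topspace (mtop N)"
    if "q \<in> topspace (mtop N.M)" for q using that by auto
  ultimately have "connectedin (mtop N.M) {r \<in> topspace (mtop N.M). fst r = fst q}"
    if "q \<in> topspace (mtop N.M)" for q using that by auto
  then show "(`) \<phi> ` restrict_foliation (mtop M) (slice_foliation I L) \<Omega> = slice_foliation J N"
    unfolding slice_foliation_eq[OF neL, of I f] slice_foliation_eq[OF neN, of J h]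
  proof (intro corr)
    show "\<exists>T. openin (mtop M) T \<and> p \<in> T \<and> (\<forall>q\<in>T \<inter> \<Omega>. fst q = fst p \<longrightarrow> fst (\<phi> q) = fst (\<phi> p))"
      if "p \<in> \<Omega>" for p using loc\<phi>[OF that] by (metis IntD1)
    show "\<exists>T. openin (mtop N.M) T \<and> q \<in> T \<and> (\<forall>r\<in>T. fst r = fst q \<longrightarrow> fst (\<psi> r) = fst (\<psi> q))"
      if "q \<in> topspace (mtop N.M)" for q using loc\<psi>[OF that] by metis
  qed blast
qed

end

text \<open>Both conjuncts rest on the vanishing of the spatial part in \<open>W_eq_0\<close>. For
  foliations it is applied, chart by chart, to the pulled-back field of the given decomposition; for
  vector fields it is applied to \<open>V\<close> itself, and connectedness of \<Omega> merges the
  local constants into one.\<close>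

theorem corollary6p5:
  fixes I :: "real set" and f :: "real \<Rightarrow> real"
    and L :: "('l, real ^ 3, 'i) metric_manifold"
    and \<Omega> :: "(real \<times> 'l) set"
  assumes "is_Friedmann I f L"
    and "openin (mtop (warped_product I f L)) \<Omega>" and "\<Omega> \<noteq> {}"
    and "connectedin (mtop (warped_product I f L)) \<Omega>"
  shows "(\<forall>(J :: real set) (h :: real \<Rightarrow> real) (N :: ('n, 'e::euclidean_space, 'j) metric_manifold) \<phi>.
            is_GRW J h N \<and>
            isometry (open_submanifold (warped_product I f L) \<Omega>) (warped_product J h N) \<phi> \<longrightarrow>
            (`) \<phi> ` restrict_foliation (mtop (warped_product I f L)) (time_foliation I L) \<Omega>
              = time_foliation J N \<and>
            (`) \<phi> ` restrict_foliation (mtop (warped_product I f L)) (slice_foliation I L) \<Omega>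
              = slice_foliation J N)
       \<and> (\<forall>V. smooth_vector_field (open_submanifold (warped_product I f L) \<Omega>) V \<and>
            timelike_field (open_submanifold (warped_product I f L) \<Omega>) V \<and>
            closed_field (open_submanifold (warped_product I f L) \<Omega>) V \<and>
            conformal_field (open_submanifold (warped_product I f L) \<Omega>) V \<longrightarrow>
            (\<exists>c::real. \<forall>i\<in>idx (warped_product I f L). \<forall>p\<in>cdom (warped_product I f L) i \<inter> \<Omega>.
               V i p = c *\<^sub>R f_dt f i p))"
proof -
  interpret friedmann I f L \<Omega>
    by unfold_locales (use assms in \<open>simp_all add: is_Friedmann_def\<close>)
  have fol: "(`) \<phi> ` restrict_foliation (mtop M) (time_foliation I L) \<Omega> = time_foliation J N \<and>
      (`) \<phi> ` restrict_foliation (mtop M) (slice_foliation I L) \<Omega> = slice_foliation J N"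
    if N: "is_GRW J h N" and iso: "isometry M\<Omega> (warped_product J h N) \<phi>"
    for J h and N :: "('n, 'e::euclidean_space, 'j) metric_manifold" and \<phi>
  proof -
    interpret N: grw J h N by (rule grw.intro[OF N])
    obtain \<psi> where \<psi>: "smooth_map N.M M\<Omega> \<psi>" "\<forall>p\<in>topspace (mtop M\<Omega>). \<psi> (\<phi> p) = p"
        "\<forall>q\<in>topspace (mtop N.M). \<phi> (\<psi> q) = q"
      using iso unfolding isometry_def by blast
    have top: "topspace (mtop M\<Omega>) = \<Omega>"
      using openin_subset[OF assms(2)] by (simp add: Int_absorb1)
    have met: "gmet M\<Omega> i p u v
        = gmet N.M j (\<phi> p) (differential M\<Omega> N.M \<phi> i j p u) (differential M\<Omega> N.M \<phi> i j p v)"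
      if "i \<in> idx L" "j \<in> idx N" "p \<in> cdom M\<Omega> i" "\<phi> p \<in> cdom N.M j" for i j p u v
      using iso that unfolding isometry_def by (metis open_submanifold_simps(2) warped_product_simps(2))
    interpret friedmann_isometry I f L \<Omega> J h N \<phi> \<psi>
    proof unfold_locales
      show "smooth_map M\<Omega> N.M \<phi>" using iso unfolding isometry_def by blast
      show "smooth_map N.M M\<Omega> \<psi>" by (rule \<psi>(1))
      show "\<psi> (\<phi> p) = p" if "p \<in> \<Omega>" for p using \<psi>(2) that unfolding top by blast
      show "\<phi> (\<psi> q) = q" if "q \<in> topspace (mtop N.M)" for q using \<psi>(3) that by blast
    qed (rule met)
    show ?thesis using foliations_correspond[OF assms(3)] by blast
  qed
  show ?thesis
  proof (intro conjI allI impI; elim conjE)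
    fix V
    assume "smooth_vector_field M\<Omega> V" "closed_field M\<Omega> V" "conformal_field M\<Omega> V"
    then show "\<exists>c. \<forall>i\<in>idx M. \<forall>p\<in>cdom M i \<inter> \<Omega>. V i p = c *\<^sub>R f_dt f i p"
      using assms(4) by (rule V_multiple)
  qed (rule fol[THEN conjunct1] fol[THEN conjunct2]; assumption)+
qed

end
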